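(* Let $\alpha\colon G\to G$ be an expansive automorphism of a totally disconnected, locally compact group $G$. Then there exist $\alpha$-stable closed subgroups \[ G=G_0\supseteq G_1\supseteq\cdots\supseteq G_n=\{1\} \] of $G$ such that $G_j$ is normal in $G_{j-1}$ for each $j\in\{1,\ldots,n\}$ and every $\alpha_j$-stable closed normal subgroup of $G_{j-1}/G_j$ is discrete or open, where $\alpha_j\colon G_{j-1}/G_j\to G_{j-1}/G_j$, $gG_j\mapsto\alpha(g)G_j$, denotes the induced automorphism. Moreover, one can achieve in addition that each of the quotient groups $G_{j-1}/G_j$ is discrete, abelian or topologically perfect.
   Context: All topological groups are Hausdorff. An automorphism of a topological group is a group automorphism $\alpha$ such that both $\alpha$ and $\alpha^{-1}$ are continuous. A subset $H\subseteq G$ is $\alpha$-stable if $\alpha(H)=H$. An automorphism $\alpha$ of a topological group $G$ is called expansive if $\bigcap_{n\in\mathbb{Z}}\alpha^n(U)=\{1\}$ for some identity neighbourhood $U\subseteq G$. A topological group is topologically perfect if its commutator group is dense in it. *)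

theory Defs
  imports "HOL-Analysis.Abstract_Topological_Spaces" "HOL-Algebra.Solvable_Groups"
begin

text \<open>
  Groups are carrier-based and topologies are values of type \<open>'a topology\<close>, because the
  statement is about closed subgroups and their quotients.  The Hausdorff axiom is part of the
  notion of a topological group.
\<close>

locale topological_group = group G for G (structure) and T :: "'a topology" +
  assumes topspace_eq_carrier: "topspace T = carrier G"
    and continuous_mult: "continuous_map (prod_topology T T) T (\<lambda>(x, y). x \<otimes> y)"
    and continuous_inv: "continuous_map T T (\<lambda>x. inv x)"
    and Hausdorff: "Hausdorff_space T"

definition totally_disconnected_space :: "'a topology \<Rightarrow> bool" where
  "totally_disconnected_space X \<longleftrightarrow> (\<forall>C. connectedin X C \<longrightarrow> (\<exists>x. C \<subseteq> {x}))"

definition topological_automorphism ::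
  "('a, 'b) monoid_scheme \<Rightarrow> 'a topology \<Rightarrow> ('a \<Rightarrow> 'a) \<Rightarrow> bool" where
  "topological_automorphism G T \<alpha> \<longleftrightarrow>
     \<alpha> \<in> iso G G \<and> continuous_map T T \<alpha> \<and> continuous_map T T (inv_into (carrier G) \<alpha>)"

text \<open>
  The \<open>n\<close>-th iterate, \<open>n\<close> an integer, of a bijection of the set \<open>A\<close> onto itself; the values
  outside \<open>A\<close> are irrelevant.
\<close>

definition int_iterate :: "'a set \<Rightarrow> ('a \<Rightarrow> 'a) \<Rightarrow> int \<Rightarrow> 'a \<Rightarrow> 'a" where
  "int_iterate A f n = (if 0 \<le> n then f ^^ nat n else inv_into A f ^^ nat (- n))"

text \<open>Identity neighbourhoods need not be open.\<close>

definition identity_neighbourhood ::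
  "('a, 'b) monoid_scheme \<Rightarrow> 'a topology \<Rightarrow> 'a set \<Rightarrow> bool" where
  "identity_neighbourhood G T U \<longleftrightarrow>
     U \<subseteq> carrier G \<and> (\<exists>V. openin T V \<and> \<one>\<^bsub>G\<^esub> \<in> V \<and> V \<subseteq> U)"

definition expansive ::
  "('a, 'b) monoid_scheme \<Rightarrow> 'a topology \<Rightarrow> ('a \<Rightarrow> 'a) \<Rightarrow> bool" where
  "expansive G T \<alpha> \<longleftrightarrow>
     (\<exists>U. identity_neighbourhood G T U \<and>
          (\<Inter>n::int. int_iterate (carrier G) \<alpha> n ` U) = {\<one>\<^bsub>G\<^esub>})"

definition topologically_perfect :: "('a, 'b) monoid_scheme \<Rightarrow> 'a topology \<Rightarrow> bool" where
  "topologically_perfect G T \<longleftrightarrow> T closure_of (derived G (carrier G)) = carrier G"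

definition quotient_topology ::
  "('a, 'b) monoid_scheme \<Rightarrow> 'a topology \<Rightarrow> 'a set \<Rightarrow> 'a set topology" where
  "quotient_topology G T H =
     topology (\<lambda>\<U>. \<U> \<subseteq> carrier (G Mod H) \<and> openin T {x \<in> carrier G. H #>\<^bsub>G\<^esub> x \<in> \<U>})"

lemma openin_quotient_topology:
  "openin (quotient_topology G T H) \<U> \<longleftrightarrow>
     \<U> \<subseteq> carrier (G Mod H) \<and> openin T {x \<in> carrier G. H #>\<^bsub>G\<^esub> x \<in> \<U>}"
proof -
  let ?P = "\<lambda>\<U>. {x \<in> carrier G. H #>\<^bsub>G\<^esub> x \<in> \<U>}"
  have "?P (\<U> \<inter> \<V>) = ?P \<U> \<inter> ?P \<V>" "?P (\<Union>\<K>) = (\<Union>\<U>\<in>\<K>. ?P \<U>)" for \<U> \<V> \<K>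
    by auto
  then have "istopology (\<lambda>\<U>. \<U> \<subseteq> carrier (G Mod H) \<and> openin T (?P \<U>))"
    unfolding istopology_def by (auto intro!: openin_Union)
  then show ?thesis
    by (simp add: quotient_topology_def)
qed

lemma topspace_quotient_topology:
  assumes "topspace T = carrier G"
  shows "topspace (quotient_topology G T H) = carrier (G Mod H)"
proof -
  have *: "{x \<in> carrier G. H #>\<^bsub>G\<^esub> x \<in> carrier (G Mod H)} = topspace T"
    using assms by (auto simp: carrier_FactGroup)
  have "openin (quotient_topology G T H) (carrier (G Mod H))"
    unfolding openin_quotient_topology * by simp
  then show ?thesis
    by (meson openin_quotient_topology openin_subset openin_topspace subset_antisym)
qed

lemma quotient_map_quotient_topology:
  assumes "topspace T = carrier G"
  shows "quotient_map T (quotient_topology G T H) (\<lambda>x. H #>\<^bsub>G\<^esub> x)"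
  unfolding quotient_map_def topspace_quotient_topology[OF assms] openin_quotient_topology assms
  by (auto simp: carrier_FactGroup)

text \<open>
  The induced map on cosets is the image map; for stable \<open>H\<close> it sends the coset of \<open>g\<close> to the
  coset of \<open>\<alpha> g\<close>.
\<close>

definition induced_map :: "('a \<Rightarrow> 'a) \<Rightarrow> 'a set \<Rightarrow> 'a set" where
  "induced_map \<alpha> C = \<alpha> ` C"

lemma induced_map_coset:
  assumes "\<alpha> \<in> hom G G" "H \<subseteq> carrier G" "\<alpha> ` H = H" "g \<in> carrier G"
  shows "induced_map \<alpha> (H #>\<^bsub>G\<^esub> g) = H #>\<^bsub>G\<^esub> \<alpha> g"
proof -
  have "\<alpha> ` (H #>\<^bsub>G\<^esub> g) = (\<lambda>h. \<alpha> h \<otimes>\<^bsub>G\<^esub> \<alpha> g) ` H"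
    using assms(2,4) hom_mult[OF assms(1)]
    by (force simp: r_coset_def image_iff subset_iff)
  also have "\<dots> = \<alpha> ` H #>\<^bsub>G\<^esub> \<alpha> g"
    by (auto simp: r_coset_def)
  finally show ?thesis
    using assms(3) by (simp add: induced_map_def)
qed

end

theory Submission
  imports Defs
begin

text \<open>
  Let \<open>V\<close> be a compact open subgroup inside an expansive identity neighbourhood, so that the sets
  \<open>\<Inter>\<bar>i\<bar>\<le>k. \<alpha>\<^sup>i(V)\<close> form a neighbourhood base at the identity. To an \<open>\<alpha>\<close>-stable closed subgroup \<open>M\<close>
  attach the finite set \<open>reach M\<close> of all cosets of \<open>V\<close> that contain, for every \<open>k\<close>, an element of \<open>M\<close>
  whose first \<open>k\<close> forward (or first \<open>k\<close> backward) iterates lie in \<open>V\<close>. It is monotone in \<open>M\<close>, and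
  for \<open>N \<subseteq> M\<close> we have \<open>reach N = reach M\<close> if and only if \<open>N\<close> is open in \<open>M\<close>: equality lets one correct
  an element of \<open>M\<close> by elements of \<open>N\<close> so that its orbit stays in \<open>V\<close> for longer and longer, so the
  element lies in the closure of \<open>N\<close>. Thus \<open>reach\<close> can change only boundedly often along a chain of
  stable closed subgroups, which gives a subnormal chain in which it changes as often as possible;
  then \<open>K/N\<close> is discrete or open in \<open>H/N\<close> for every admissible \<open>K\<close> between two consecutive
  members \<open>H\<close>, \<open>N\<close>.

  For the last assertion take \<open>H\<close>, \<open>N\<close> in such a chain and let \<open>P\<close> be the intersection of all
  stable closed normal subgroups \<open>K \<supseteq> N\<close> of \<open>H\<close> that are open in \<open>H\<close>. By compactness
  \<open>reach P = reach H\<close>, so \<open>P\<close> is itself open. Let \<open>D\<close> be the closure of \<open>[P, P] N\<close>. If \<open>D\<close> is open in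
  \<open>H\<close>, then \<open>D = P\<close> by minimality and \<open>P/N\<close> is topologically perfect; otherwise \<open>N\<close> is open in \<open>D\<close>,
  and \<open>H \<supseteq> P \<supseteq> D \<supseteq> N\<close> has discrete, abelian and discrete quotients.
\<close>

section \<open>Topological groups\<close>

context topological_group
begin

lemma openin_carrier: "openin T S \<Longrightarrow> S \<subseteq> carrier G"
  using openin_subset topspace_eq_carrier by blast

lemma closedin_carrier: "closedin T S \<Longrightarrow> S \<subseteq> carrier G"
  using closedin_subset topspace_eq_carrier by blast

lemma continuous_map_left_translation:
  assumes "a \<in> carrier G"
  shows "continuous_map T T (\<lambda>x. a \<otimes> x)"
proof -
  have "continuous_map T (prod_topology T T) (\<lambda>x. (a, x))"
    using assms topspace_eq_carrier by (simp add: continuous_map_pairedI)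
  from continuous_map_compose[OF this continuous_mult] show ?thesis
    by (simp add: o_def)
qed

lemma continuous_map_right_translation:
  assumes "a \<in> carrier G"
  shows "continuous_map T T (\<lambda>x. x \<otimes> a)"
proof -
  have "continuous_map T (prod_topology T T) (\<lambda>x. (x, a))"
    using assms topspace_eq_carrier by (simp add: continuous_map_pairedI)
  from continuous_map_compose[OF this continuous_mult] show ?thesis
    by (simp add: o_def)
qed

lemma continuous_map_conjugation:
  assumes "a \<in> carrier G"
  shows "continuous_map T T (\<lambda>x. a \<otimes> x \<otimes> inv a)"
  using continuous_map_compose[OF continuous_map_left_translation[OF assms]
      continuous_map_right_translation, of "inv a"] assms
  by (simp add: o_def)

lemma r_coset_eq_vimage:
  assumes "a \<in> carrier G" "S \<subseteq> carrier G"
  shows "S #> a = {x \<in> carrier G. x \<otimes> inv a \<in> S}"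
proof -
  have "x \<in> S #> a" if "x \<in> carrier G" "x \<otimes> inv a \<in> S" for x
    using that assms by (force simp: r_coset_def m_assoc intro!: bexI[of _ "x \<otimes> inv a"])
  then show ?thesis
    using assms by (auto simp: r_coset_def m_assoc subset_iff)
qed

lemma openin_r_coset:
  assumes "a \<in> carrier G" "openin T S"
  shows "openin T (S #> a)"
  using openin_continuous_map_preimage[OF continuous_map_right_translation assms(2), of "inv a"]
    r_coset_eq_vimage[OF assms(1) openin_carrier[OF assms(2)]] assms(1)
  by (simp add: topspace_eq_carrier)

lemma closedin_r_coset:
  assumes "a \<in> carrier G" "closedin T S"
  shows "closedin T (S #> a)"
  using closedin_continuous_map_preimage[OF continuous_map_right_translation assms(2), of "inv a"]
    r_coset_eq_vimage[OF assms(1) closedin_carrier[OF assms(2)]] assms(1)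
  by (simp add: topspace_eq_carrier)

lemma mem_r_coset_iff:
  assumes "subgroup H G" "x \<in> carrier G" "y \<in> carrier G"
  shows "x \<in> H #> y \<longleftrightarrow> x \<otimes> inv y \<in> H"
  using assms r_coset_eq_vimage[OF assms(3) subgroup.subset[OF assms(1)]] by simp

lemma r_coset_eq_iff:
  assumes "subgroup H G" "x \<in> carrier G" "y \<in> carrier G"
  shows "H #> x = H #> y \<longleftrightarrow> x \<otimes> inv y \<in> H"
proof -
  have "H #> x = H #> y \<longleftrightarrow> x \<in> H #> y"
    using assms by (metis repr_independence rcos_self)
  then show ?thesis
    using mem_r_coset_iff[OF assms] by simp
qed

text \<open>The translates \<open>S #> h\<close> with \<open>h\<close> in \<open>H\<close> are open,
  stay inside \<open>H\<close> and cover it.\<close>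

lemma subgroup_openin:
  assumes "subgroup H G" "openin T S" "\<one> \<in> S" "S \<subseteq> H"
  shows "openin T H"
proof (subst openin_subopen, intro ballI)
  fix h assume h: "h \<in> H"
  then have hc: "h \<in> carrier G"
    using subgroup.mem_carrier[OF assms(1)] by blast
  have "h \<in> S #> h"
    using assms(3) hc by (force simp: r_coset_def)
  moreover have "S #> h \<subseteq> H"
    using subgroup.m_closed[OF assms(1) _ h] assms(4) by (auto simp: r_coset_def)
  ultimately show "\<exists>O'. openin T O' \<and> h \<in> O' \<and> O' \<subseteq> H"
    using openin_r_coset[OF hc assms(2)] by blast
qed

lemma open_subgroup_closedin:
  assumes "subgroup H G" "openin T H"
  shows "closedin T H"
proof -
  have "openin T (carrier G - H)"
  proof (subst openin_subopen, intro ballI)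
    fix x assume x: "x \<in> carrier G - H"
    then have "x \<in> H #> x"
      using assms(1) by (simp add: rcos_self)
    moreover have "H #> x \<subseteq> carrier G - H"
    proof
      fix y assume y: "y \<in> H #> x"
      then obtain h where h: "h \<in> H" "y = h \<otimes> x"
        by (auto simp: r_coset_def)
      then have "h \<in> carrier G"
        using subgroup.mem_carrier[OF assms(1)] by blast
      then have "x = inv h \<otimes> y"
        using h x by (simp add: inv_solve_left)
      then have "y \<notin> H"
        using x subgroup.m_closed[OF assms(1) subgroup.m_inv_closed[OF assms(1) h(1)]] by auto
      then show "y \<in> carrier G - H"
        using h x \<open>h \<in> carrier G\<close> by simp
    qed
    ultimately show "\<exists>O'. openin T O' \<and> x \<in> O' \<and> O' \<subseteq> carrier G - H"
      using openin_r_coset assms(2) x by blast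
  qed
  then show ?thesis
    using assms(1) subgroup.subset by (simp add: closedin_def topspace_eq_carrier) blast
qed

lemma subgroup_closure_of:
  assumes "subgroup H G"
  shows "subgroup (T closure_of H) G"
proof (rule subgroupI)
  have H: "H \<subseteq> carrier G"
    using assms subgroup.subset by blast
  have sub: "H \<subseteq> T closure_of H"
    using H by (simp add: closure_of_subset topspace_eq_carrier)
  show "T closure_of H \<subseteq> carrier G"
    using closure_of_subset_topspace topspace_eq_carrier by metis
  show "T closure_of H \<noteq> {}"
    using sub subgroup.one_closed[OF assms] by blast
  show "inv a \<in> T closure_of H" if "a \<in> T closure_of H" for a
  proof -
    have "(\<lambda>x. inv x) ` (T closure_of H) \<subseteq> T closure_of ((\<lambda>x. inv x) ` H)"
      using continuous_inv by (simp add: continuous_map_image_closure_subset)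
    moreover have "(\<lambda>x. inv x) ` H \<subseteq> H"
      using subgroup.m_inv_closed[OF assms] by blast
    ultimately show ?thesis
      using that closure_of_mono by blast
  qed
  show "a \<otimes> b \<in> T closure_of H" if "a \<in> T closure_of H" "b \<in> T closure_of H" for a b
  proof -
    have "(\<lambda>(x, y). x \<otimes> y) ` (prod_topology T T closure_of (H \<times> H))
        \<subseteq> T closure_of ((\<lambda>(x, y). x \<otimes> y) ` (H \<times> H))"
      using continuous_mult by (rule continuous_map_image_closure_subset)
    moreover have "(\<lambda>(x, y). x \<otimes> y) ` (H \<times> H) \<subseteq> H"
      using subgroup.m_closed[OF assms] by auto
    moreover have "(a, b) \<in> prod_topology T T closure_of (H \<times> H)"
      using that by (simp add: closure_of_Times)
    ultimately show ?thesis
      using closure_of_mono by (metis (no_types, lifting) case_prod_conv image_subset_iff subset_iff)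
  qed
qed

section \<open>Compact open subgroups (van Dantzig's theorem)\<close>

text \<open>Components are points, so \<open>{x}\<close> is a compact component, and in a locally
  compact Hausdorff space such a component can be enclosed in a clopen \<open>C\<close> inside a
  given open neighbourhood. Taking \<open>C\<close> inside a compact set as well makes it
  compact.\<close>

lemma exists_compact_open_subset:
  assumes "totally_disconnected_space T" "locally_compact_space T" "openin T W" "x \<in> W"
  obtains C where "openin T C" "compactin T C" "x \<in> C" "C \<subseteq> W"
proof -
  have x: "x \<in> topspace T"
    using assms(3,4) openin_subset by blast
  obtain A K where A: "openin T A" "compactin T K" "x \<in> A" "A \<subseteq> K"
    using assms(2) x unfolding locally_compact_space_def by blast
  have "connected_component_of_set T x = {x}"
  proof -
    obtain y where "connected_component_of_set T x \<subseteq> {y}"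
      using assms(1) connectedin_connected_component_of unfolding totally_disconnected_space_def by metis
    moreover have "x \<in> connected_component_of_set T x"
      using x by (simp add: connected_component_of_refl)
    ultimately show ?thesis
      by blast
  qed
  then have "{x} \<in> connected_components_of T"
    using x unfolding connected_components_of_def by blast
  then obtain C D where CD: "openin T C" "openin T D" "disjnt C D" "C \<union> D = topspace T"
    "{x} \<subseteq> C" "C \<subseteq> A \<inter> W"
    using wilder_locally_compact_component_thm[of T "{x}" "A \<inter> W"] assms(2-4) Hausdorff A x
    by (metis (no_types, lifting) Int_iff compactin_sing empty_subsetI insert_subset openin_Int)
  have "closedin T C"
    using CD by (metis closedin_def Diff_cancel Un_Diff disjnt_def Diff_triv inf.commute openin_subset sup_bot_left)
  then have "compactin T C"
    using A CD by (meson closed_compactin inf.boundedE order_trans)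
  then show ?thesis
    using that CD by blast
qed

text \<open>The stabiliser under right translation of a compact open set \<open>C\<close> containing
  the identity is a subgroup inside \<open>C\<close>. It is open because a tube argument gives a
  neighbourhood \<open>B\<close> of the identity with \<open>C B\<close> inside
  \<open>C\<close>.\<close>

lemma exists_compact_open_subgroup:
  assumes "totally_disconnected_space T" "locally_compact_space T" "openin T W" "\<one> \<in> W"
  obtains V where "subgroup V G" "openin T V" "compactin T V" "V \<subseteq> W"
proof -
  obtain C where C: "openin T C" "compactin T C" "\<one> \<in> C" "C \<subseteq> W"
    using exists_compact_open_subset[OF assms] by blast
  have Cc: "C \<subseteq> carrier G"
    using C openin_carrier by blast
  define V where "V = {x \<in> carrier G. (\<forall>c\<in>C. c \<otimes> x \<in> C) \<and> (\<forall>c\<in>C. c \<otimes> inv x \<in> C)}"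
  have V: "subgroup V G"
  proof (rule subgroupI)
    show "V \<noteq> {}"
      using Cc by (auto simp: V_def subset_iff intro!: exI[of _ "\<one>"])
    show "a \<otimes> b \<in> V" if "a \<in> V" "b \<in> V" for a b
      using that Cc by (auto simp: V_def subset_iff inv_mult_group simp flip: m_assoc)
  qed (auto simp: V_def)
  obtain A B where AB: "openin T A" "openin T B" "C \<subseteq> A" "{\<one>} \<subseteq> B"
    "A \<times> B \<subseteq> {z \<in> topspace (prod_topology T T). (case z of (x, y) \<Rightarrow> x \<otimes> y) \<in> C}"
  proof (rule Wallace_theorem_prod_topology)
    show "compactin T C" "compactin T {\<one>}"
      using C by (auto simp: topspace_eq_carrier)
    show "openin (prod_topology T T) {z \<in> topspace (prod_topology T T). (case z of (x, y) \<Rightarrow> x \<otimes> y) \<in> C}"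
      using openin_continuous_map_preimage[OF continuous_mult C(1)] .
    show "C \<times> {\<one>} \<subseteq> {z \<in> topspace (prod_topology T T). (case z of (x, y) \<Rightarrow> x \<otimes> y) \<in> C}"
      using Cc by (auto simp: topspace_eq_carrier subset_iff)
  qed
  \<comment> \<open>Intersecting \<open>B\<close> with its inverse serves both conditions in
    \<open>V\<close>.\<close>
  let ?B = "B \<inter> {x \<in> topspace T. inv x \<in> B}"
  have "openin T V"
  proof (rule subgroup_openin[OF V])
    show "openin T ?B"
      using AB openin_continuous_map_preimage[OF continuous_inv AB(2)] by blast
    show "\<one> \<in> ?B"
      using AB by (auto simp: topspace_eq_carrier)
    show "?B \<subseteq> V"
      using AB by (auto simp: V_def topspace_eq_carrier subset_iff)
  qed
  moreover have "V \<subseteq> C"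
    using C(3) by (force simp: V_def)
  moreover have "compactin T V"
    using open_subgroup_closedin[OF V \<open>openin T V\<close>] C(2) \<open>V \<subseteq> C\<close> closed_compactin by blast
  ultimately show ?thesis
    using that V C by blast
qed

end

section \<open>Two-sided orbits and relatively open subgroups\<close>

text \<open>The maps \<open>\<phi> i\<close> stand for the integer iterates of the automorphism,
  axiomatised as an action of the integers by continuous endomorphisms. \<open>V_expansive\<close>
  expresses expansiveness through orbits.\<close>

locale expansive_system = topological_group G T for G (structure) and T :: "'a topology" +
  fixes \<phi> :: "int \<Rightarrow> 'a \<Rightarrow> 'a" and V :: "'a set"
  assumes iter_hom: "\<phi> i \<in> hom G G"
    and iter_continuous: "continuous_map T T (\<phi> i)"
    and iter_zero: "x \<in> carrier G \<Longrightarrow> \<phi> 0 x = x"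
    and iter_add: "x \<in> carrier G \<Longrightarrow> \<phi> i (\<phi> j x) = \<phi> (i + j) x"
    and V_subgroup: "subgroup V G"
    and V_open: "openin T V"
    and V_compact: "compactin T V"
    and V_expansive: "x \<in> carrier G \<Longrightarrow> (\<And>i. \<phi> i x \<in> V) \<Longrightarrow> x = \<one>"
begin

text \<open>Inclusion for every integer is enough: used for \<open>- i\<close> as well, it gives the
  equality of \<open>iter_image_stable\<close>.\<close>

definition stable_subgroup :: "'a set \<Rightarrow> bool" where
  "stable_subgroup M \<longleftrightarrow> subgroup M G \<and> closedin T M \<and> (\<forall>i. \<forall>x\<in>M. \<phi> i x \<in> M)"

definition window :: "int set \<Rightarrow> 'a set" where
  "window J = {x \<in> carrier G. \<forall>i\<in>J. \<phi> i x \<in> V}"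

text \<open>Time 0 is left out on purpose: the coset of \<open>V\<close> containing a point records
  where the point is at time 0. The flag \<open>s\<close> selects the direction.\<close>

definition ray :: "bool \<Rightarrow> nat \<Rightarrow> int set" where
  "ray s k = (if s then {1..int k} else {- int k..-1})"

text \<open>The tag \<open>s\<close> keeps the cosets reached forwards and backwards apart within
  one finite set. The witness in \<open>M\<close> may vary with \<open>k\<close>.\<close>

definition reach :: "'a set \<Rightarrow> (bool \<times> 'a set) set" where
  "reach M = {(s, C). \<forall>k. C \<in> (\<lambda>x. V #> x) ` (M \<inter> window (ray s k))}"

lemma stable_subgroupD:
  assumes "stable_subgroup M"
  shows "subgroup M G" "closedin T M" "x \<in> M \<Longrightarrow> \<phi> i x \<in> M" "M \<subseteq> carrier G" "\<one> \<in> M"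
  using assms by (auto simp: stable_subgroup_def subgroup.one_closed dest: closedin_carrier)

lemma iter_closed: "x \<in> carrier G \<Longrightarrow> \<phi> i x \<in> carrier G"
  using iter_hom hom_in_carrier by metis

lemma iter_mult: "x \<in> carrier G \<Longrightarrow> y \<in> carrier G \<Longrightarrow> \<phi> i (x \<otimes> y) = \<phi> i x \<otimes> \<phi> i y"
  using iter_hom hom_mult by metis

lemma iter_group_hom: "group_hom G G (\<phi> i)"
  using iter_hom by unfold_locales auto

lemma iter_inv: "x \<in> carrier G \<Longrightarrow> \<phi> i (inv x) = inv (\<phi> i x)"
  using group_hom.hom_inv[OF iter_group_hom] by simp

lemma iter_one: "\<phi> i \<one> = \<one>"
  using group_hom.hom_one[OF iter_group_hom] by simp

lemma iter_image_stable:
  assumes "stable_subgroup M"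
  shows "\<phi> i ` M = M"
proof
  show "\<phi> i ` M \<subseteq> M"
    using stable_subgroupD(3)[OF assms] by blast
  show "M \<subseteq> \<phi> i ` M"
  proof
    fix x assume x: "x \<in> M"
    then have "x = \<phi> i (\<phi> (- i) x)"
      using stable_subgroupD(4)[OF assms] by (auto simp: iter_add iter_zero)
    then show "x \<in> \<phi> i ` M"
      using stable_subgroupD(3)[OF assms x] by blast
  qed
qed

lemma window_antimono: "I \<subseteq> J \<Longrightarrow> window J \<subseteq> window I"
  by (auto simp: window_def)

lemma ray_mono: "k \<le> l \<Longrightarrow> ray s k \<subseteq> ray s l"
  by (auto simp: ray_def)

lemma iter_in_window_iff:
  "x \<in> carrier G \<Longrightarrow> \<phi> j x \<in> window J \<longleftrightarrow> x \<in> window ((\<lambda>i. i + j) ` J)"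
  by (simp add: window_def iter_closed iter_add)

lemma V_closed: "closedin T V"
  using V_subgroup V_open by (rule open_subgroup_closedin)

lemma closedin_window: "closedin T (window J)"
proof -
  have "window J = carrier G \<inter> (\<Inter>i\<in>J. {x \<in> topspace T. \<phi> i x \<in> V})"
    by (auto simp: window_def topspace_eq_carrier)
  moreover have "closedin T {x \<in> topspace T. \<phi> i x \<in> V}" for i
    using closedin_continuous_map_preimage[OF iter_continuous V_closed] .
  ultimately show ?thesis
    using closedin_topspace[of T] unfolding topspace_eq_carrier
    by (cases "J = {}") (auto intro!: closedin_Int closedin_INT)
qed

text \<open>For any \<open>i\<close> in \<open>J\<close> the window is a closed subset of the
  compact image of \<open>V\<close> under \<open>\<phi> (- i)\<close>.\<close>

lemma compactin_window:
  assumes "J \<noteq> {}"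
  shows "compactin T (window J)"
proof -
  obtain i where i: "i \<in> J"
    using assms by blast
  have "window J \<subseteq> \<phi> (- i) ` V"
  proof
    fix x assume x: "x \<in> window J"
    then have "x = \<phi> (- i) (\<phi> i x)" "\<phi> i x \<in> V"
      using i by (auto simp: window_def iter_add iter_zero)
    then show "x \<in> \<phi> (- i) ` V"
      by blast
  qed
  then show ?thesis
    using closed_compactin[OF image_compactin[OF V_compact iter_continuous]] closedin_window by blast
qed

text \<open>Distinct cosets are disjoint and open, so a finite subcover of \<open>K\<close> must
  contain the coset of each of its points.\<close>

lemma finite_cosets_compact:
  assumes "compactin T K"
  shows "finite ((\<lambda>x. V #> x) ` K)"
proof -
  have K: "K \<subseteq> carrier G"
    using assms compactin_subset_topspace topspace_eq_carrier by metis
  have "K \<subseteq> \<Union> ((\<lambda>x. V #> x) ` K)"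
    using K rcos_self[OF _ V_subgroup] by blast
  moreover have "openin T U" if "U \<in> (\<lambda>x. V #> x) ` K" for U
    using that K openin_r_coset V_open by blast
  ultimately obtain \<F> where F: "finite \<F>" "\<F> \<subseteq> (\<lambda>x. V #> x) ` K" "K \<subseteq> \<Union>\<F>"
    using assms unfolding compactin_def by meson
  have "(\<lambda>x. V #> x) ` K \<subseteq> \<F>"
  proof
    fix C assume "C \<in> (\<lambda>x. V #> x) ` K"
    then obtain x where x: "x \<in> K" "C = V #> x"
      by blast
    then obtain D where D: "D \<in> \<F>" "x \<in> D"
      using F(3) by blast
    then obtain y where y: "y \<in> K" "D = V #> y"
      using F(2) by blast
    then have "V #> y = V #> x"
      using D(2) K repr_independence[OF _ _ V_subgroup] by blast
    then show "C \<in> \<F>"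
      using D(1) x(2) y(2) by simp
  qed
  then show ?thesis
    using F(1) finite_subset by blast
qed

section \<open>Finiteness of \<open>reach\<close> and windows as a neighbourhood base\<close>

lemma reach_mono: "N \<subseteq> M \<Longrightarrow> reach N \<subseteq> reach M"
  unfolding reach_def by blast

text \<open>The condition for \<open>k = 1\<close> alone confines the cosets to those of points in
  the compact windows at times 1 and -1.\<close>

lemma finite_reach: "finite (reach M)"
proof -
  have "reach M \<subseteq> (UNIV :: bool set) \<times> ((\<lambda>x. V #> x) ` window {1} \<union> (\<lambda>x. V #> x) ` window {-1})"
  proof
    fix p assume "p \<in> reach M"
    then obtain s C where p: "p = (s, C)" "(s, C) \<in> reach M"
      by (cases p) auto
    then have "C \<in> (\<lambda>x. V #> x) ` (M \<inter> window (ray s 1))"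
      using p(2) unfolding reach_def by blast
    moreover have "ray s 1 = {if s then 1 else -1}"
      by (auto simp: ray_def)
    ultimately show "p \<in> UNIV \<times> ((\<lambda>x. V #> x) ` window {1} \<union> (\<lambda>x. V #> x) ` window {-1})"
      using p(1) by (auto split: if_splits)
  qed
  moreover have "finite ((\<lambda>x. V #> x) ` window {i})" for i
    by (simp add: finite_cosets_compact compactin_window)
  ultimately show ?thesis
    by (meson finite_SigmaI finite_UnI finite_subset finite)
qed

text \<open>In each direction the sets \<open>A s k\<close> decrease with \<open>k\<close> inside a
  finite set, so from some \<open>k\<close> on only the cosets recorded in \<open>reach M\<close>
  remain.\<close>

lemma reach_attained:
  obtains k where "\<And>s l x. k \<le> l \<Longrightarrow> x \<in> M \<Longrightarrow> x \<in> window (ray s l) \<Longrightarrow> (s, V #> x) \<in> reach M"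
proof -
  define A where "A s k = (\<lambda>x. V #> x) ` (M \<inter> window (ray s k))" for s k
  have Adec: "A s l \<subseteq> A s k" if "k \<le> l" for s k l
    unfolding A_def using window_antimono[OF ray_mono[OF that]] by blast
  have "\<exists>k\<ge>1. \<forall>C\<in>A s k. (s, C) \<in> reach M" for s
  proof -
    have "A s 1 \<subseteq> (\<lambda>x. V #> x) ` window (ray s 1)"
      unfolding A_def by blast
    moreover have "ray s 1 \<noteq> {}"
      by (simp add: ray_def)
    ultimately have fin: "finite (A s 1)"
      using finite_cosets_compact compactin_window finite_subset by metis
    have "\<exists>k. (s, C) \<notin> reach M \<longrightarrow> C \<notin> A s k" for C
      unfolding reach_def A_def by blast
    then obtain f where f: "\<And>C. (s, C) \<notin> reach M \<Longrightarrow> C \<notin> A s (f C)"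
      by metis
    \<comment> \<open>A coset \<open>C\<close> outside \<open>reach M\<close> is absent at stage
      \<open>f C\<close>; the maximum over the finitely many candidates is late enough for all of
      them. The entry 1 keeps \<open>A s k\<close> inside \<open>A s 1\<close>.\<close>
    define k where "k = Max (insert 1 (f ` A s 1))"
    have k: "1 \<le> k" "\<And>C. C \<in> A s 1 \<Longrightarrow> f C \<le> k"
      unfolding k_def using fin by auto
    have "(s, C) \<in> reach M" if C: "C \<in> A s k" for C
    proof (rule ccontr)
      assume "(s, C) \<notin> reach M"
      moreover have "C \<in> A s (f C)"
        using C Adec[OF k(1)] Adec[OF k(2)] by blast
      ultimately show False
        using f by blast
    qed
    then show ?thesis
      using k(1) by blast
  qed
  then obtain g where g: "\<And>s C. C \<in> A s (g s) \<Longrightarrow> (s, C) \<in> reach M"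
    by metis
  show ?thesis
  proof (rule that[of "max (g True) (g False)"])
    fix s l x assume "max (g True) (g False) \<le> l" "x \<in> M" "x \<in> window (ray s l)"
    moreover from this have "g s \<le> l"
      by (cases s) auto
    ultimately have "V #> x \<in> A s (g s)"
      using Adec[of "g s" l s] unfolding A_def by blast
    then show "(s, V #> x) \<in> reach M"
      by (rule g)
  qed
qed

text \<open>The windows at single times are closed and, by expansiveness, meet only in the identity.
  Hence finitely many of them already exclude the compact part of \<open>V\<close> outside
  \<open>W\<close>.\<close>

lemma window_neighbourhood_base:
  assumes "openin T W" "\<one> \<in> W"
  obtains m :: nat where "window {- int m..int m} \<subseteq> W"
proof -
  let ?S = "window {0} \<inter> (carrier G - W)"
  have "closedin T (carrier G - W)"
    using assms(1) by (metis closedin_diff closedin_topspace topspace_eq_carrier)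
  then have S: "compactin T ?S"
    by (simp add: compact_Int_closedin compactin_window)
  have "?S \<inter> \<Inter> (range (\<lambda>i. window {i})) = {}"
  proof -
    have "x \<in> W" if "x \<in> carrier G" "\<And>i. x \<in> window {i}" for x
      using that V_expansive[of x] assms(2) by (auto simp: window_def)
    then show ?thesis
      by (auto simp: window_def)
  qed
  then obtain \<F> where F: "finite \<F>" "\<F> \<subseteq> range (\<lambda>i. window {i})" "?S \<inter> \<Inter>\<F> = {}"
    using S closedin_window unfolding compactin_fip by (metis (no_types, lifting) rangeE)
  then obtain I where I: "finite I" "\<F> = (\<lambda>i. window {i}) ` I"
    by (meson finite_subset_image)
  \<comment> \<open>The symmetric interval up to \<open>m\<close> contains all times in
    \<open>I\<close>; the entry 0 covers an empty \<open>I\<close>.\<close>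
  define m where "m = Max (insert 0 ((\<lambda>i. nat \<bar>i\<bar>) ` I))"
  have m: "i \<in> {- int m..int m}" if "i \<in> I" for i
  proof -
    have "nat \<bar>i\<bar> \<le> m"
      unfolding m_def using I(1) that by auto
    then show ?thesis
      by auto
  qed
  show ?thesis
  proof (rule that[of m], rule subsetI)
    fix x assume x: "x \<in> window {- int m..int m}"
    then have "x \<in> window {0}" "x \<in> carrier G"
      by (auto simp: window_def)
    moreover have "x \<in> \<Inter>\<F>"
      using x m unfolding I(2) by (auto simp: window_def)
    ultimately show "x \<in> W"
      using F(3) by blast
  qed
qed

section \<open>Equality of \<open>reach\<close> and relative openness\<close>

text \<open>Stability allows shifts in time: an element of \<open>M\<close> whose orbit stays in
  \<open>V\<close> throughout some interval of length \<open>2 * k\<close> lies in \<open>N\<close>.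
  A long ray contains such an interval.\<close>

lemma reach_eq_if_relatively_open:
  assumes "stable_subgroup M" "stable_subgroup N" "N \<subseteq> M"
    and k: "M \<inter> window {- int k..int k} \<subseteq> N"
  shows "reach N = reach M"
proof
  show "reach N \<subseteq> reach M"
    using assms(3) by (rule reach_mono)
  have shift: "x \<in> N" if x: "x \<in> M" "x \<in> window {a..b}" and ab: "2 * int k \<le> b - a" for x a b
  proof -
    have xc: "x \<in> carrier G"
      using x(2) by (simp add: window_def)
    have "\<phi> (a + int k) x \<in> window {- int k..int k}"
      unfolding iter_in_window_iff[OF xc] using x(2) by (rule subsetD[OF window_antimono, rotated]) (use ab in auto)
    then have "\<phi> (a + int k) x \<in> N"
      using k stable_subgroupD(3)[OF assms(1) x(1)] by blast
    then have "\<phi> (- (a + int k)) (\<phi> (a + int k) x) \<in> N"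
      using stable_subgroupD(3)[OF assms(2)] by blast
    then show ?thesis
      using xc by (simp add: iter_add iter_zero)
  qed
  \<comment> \<open>The interval \<open>{1..l + 2 * k + 1}\<close> and its mirror image have length
    \<open>l + 2 * k\<close>, at least the \<open>2 * k\<close> required by
    \<open>shift\<close>.\<close>
  have "x \<in> N" if "x \<in> M" "x \<in> window (ray s (l + 2 * k + 1))" for x s l
    using that shift[of x 1 "int (l + 2 * k + 1)"] shift[of x "- int (l + 2 * k + 1)" "-1"]
    by (cases s) (auto simp: ray_def)
  then have "M \<inter> window (ray s (l + 2 * k + 1)) \<subseteq> N \<inter> window (ray s l)" for s l
    using window_antimono[OF ray_mono, of l "l + 2 * k + 1" s] by auto
  then have "(\<lambda>x. V #> x) ` (M \<inter> window (ray s (l + 2 * k + 1))) \<subseteq> (\<lambda>x. V #> x) ` (N \<inter> window (ray s l))" for s l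
    by (rule image_mono)
  then show "reach M \<subseteq> reach N"
    unfolding reach_def by blast
qed

lemma window_mult_inv:
  assumes "x \<in> window J" "y \<in> window J"
  shows "x \<otimes> inv y \<in> window J"
  using assms V_subgroup
  by (auto simp: window_def iter_mult iter_inv subgroup.m_closed subgroup.m_inv_closed)

text \<open>An element of \<open>M\<close> with a long orbit segment in \<open>V\<close> is
  corrected by elements of \<open>N\<close>, one time step after another, until the segment exceeds
  any bound. The corrected elements then approach the identity, and closedness of \<open>N\<close>
  puts the original element into \<open>N\<close>.\<close>

lemma relatively_open_if_reach_eq:
  assumes M: "stable_subgroup M" and N: "stable_subgroup N" and "N \<subseteq> M" "reach N = reach M"
  obtains k :: nat where "M \<inter> window {- int k..int k} \<subseteq> N"
proof -
  obtain k where k: "\<And>s l x. k \<le> l \<Longrightarrow> x \<in> M \<Longrightarrow> x \<in> window (ray s l) \<Longrightarrow> (s, V #> x) \<in> reach M"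
    using reach_attained[of M] by blast
  \<comment> \<open>The coset of \<open>x\<close> is also reached from \<open>N\<close>, so some
    \<open>y\<close> in \<open>N\<close> has the same coset and follows the same ray; for
    \<open>x \<otimes> inv y\<close> time 0 is gained.\<close>
  have ext: "\<exists>y\<in>N. x \<otimes> inv y \<in> M \<inter> window (insert 0 (ray s l))"
    if x: "x \<in> M" "x \<in> window (ray s l)" and l: "k \<le> l" for x s l
  proof -
    have "(s, V #> x) \<in> reach N"
      using k[OF l x] assms(4) by simp
    then obtain y where y: "y \<in> N" "y \<in> window (ray s l)" "V #> x = V #> y"
      unfolding reach_def by blast
    have c: "x \<in> carrier G" "y \<in> carrier G"
      using x(2) y(2) by (auto simp: window_def)
    have "x \<otimes> inv y \<in> V"
      using y(3) r_coset_eq_iff[OF V_subgroup c] by simp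
    then have "x \<otimes> inv y \<in> window (insert 0 (ray s l))"
      using window_mult_inv[OF x(2) y(2)] c by (simp add: window_def iter_zero)
    moreover have "x \<otimes> inv y \<in> M"
      using stable_subgroupD(1)[OF M] x(1) y(1) assms(3) by (meson subgroup.m_closed subgroup.m_inv_closed subsetD)
    ultimately show ?thesis
      using y(1) by blast
  qed
  \<comment> \<open>The same gain at an arbitrary time \<open>j\<close>: \<open>ext\<close> is
    applied to \<open>\<phi> j x\<close> and its correcting element is pulled back by
    \<open>\<phi> (- j)\<close>.\<close>
  have shift: "\<exists>y\<in>N. x \<otimes> inv y \<in> M \<inter> window ((\<lambda>i. i + j) ` insert 0 (ray s l))"
    if x: "x \<in> M" "x \<in> window ((\<lambda>i. i + j) ` ray s l)" and l: "k \<le> l" for x s l j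
  proof -
    have xc: "x \<in> carrier G"
      using x(2) by (simp add: window_def)
    have "\<phi> j x \<in> window (ray s l)"
      using x(2) by (simp add: iter_in_window_iff[OF xc])
    then obtain y where y: "y \<in> N" "\<phi> j x \<otimes> inv y \<in> M \<inter> window (insert 0 (ray s l))"
      using ext[OF stable_subgroupD(3)[OF M x(1)] _ l] by blast
    define z where "z = \<phi> (- j) y"
    have z: "z \<in> N"
      unfolding z_def using stable_subgroupD(3)[OF N y(1)] .
    then have zc: "z \<in> carrier G" and yc: "y \<in> carrier G"
      using stable_subgroupD(4)[OF N] y(1) by auto
    have "\<phi> j z = y"
      unfolding z_def using yc by (simp add: iter_add iter_zero)
    then have "\<phi> j (x \<otimes> inv z) = \<phi> j x \<otimes> inv y"
      using xc zc by (simp add: iter_mult iter_inv)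
    then have "x \<otimes> inv z \<in> window ((\<lambda>i. i + j) ` insert 0 (ray s l))"
      using y(2) xc zc iter_in_window_iff[of "x \<otimes> inv z" j "insert 0 (ray s l)"] by simp
    moreover have "x \<otimes> inv z \<in> M"
      using stable_subgroupD(1)[OF M] x(1) z assms(3) by (meson subgroup.m_closed subgroup.m_inv_closed subsetD)
    ultimately show ?thesis
      using z by blast
  qed
  have left: "\<exists>y\<in>N. x \<otimes> inv y \<in> M \<inter> window {a - 1..b}"
    if "x \<in> M" "x \<in> window {a..b}" "int k \<le> b - a" for x a b
  proof -
    \<comment> \<open>The \<open>b - a + 1\<close> times in \<open>{a..b}\<close> are a forward ray
      moved by \<open>a - 1\<close>, so the time gained is \<open>a - 1\<close>. The bound on
      \<open>b - a\<close> makes this ray long enough for \<open>shift\<close>.\<close>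
    have eq: "{a..b} = (\<lambda>i. i + (a - 1)) ` ray True (nat (b - a + 1))"
      using that(3) by (simp add: ray_def)
    have "{a - 1..b} = insert (a - 1) {a..b}"
      using that(3) by auto
    then have eq2: "{a - 1..b} = (\<lambda>i. i + (a - 1)) ` insert 0 (ray True (nat (b - a + 1)))"
      by (simp only: image_insert add_0 flip: eq)
    show ?thesis
      unfolding eq2 using that(1) that(2)[unfolded eq] by (rule shift) (use that(3) in simp)
  qed
  have right: "\<exists>y\<in>N. x \<otimes> inv y \<in> M \<inter> window {a..b + 1}"
    if "x \<in> M" "x \<in> window {a..b}" "int k \<le> b - a" for x a b
  proof -
    have eq: "{a..b} = (\<lambda>i. i + (b + 1)) ` ray False (nat (b - a + 1))"
      using that(3) by (simp add: ray_def)
    have "{a..b + 1} = insert (b + 1) {a..b}"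
      using that(3) by auto
    then have eq2: "{a..b + 1} = (\<lambda>i. i + (b + 1)) ` insert 0 (ray False (nat (b - a + 1)))"
      by (simp only: image_insert add_0 flip: eq)
    show ?thesis
      unfolding eq2 using that(1) that(2)[unfolded eq] by (rule shift) (use that(3) in simp)
  qed
  \<comment> \<open>Corrections by \<open>y1\<close> and then \<open>y2\<close> amount to a single
    one by \<open>y2 \<otimes> y1\<close>.\<close>
  have mult: "\<exists>y\<in>N. x \<otimes> inv y = z" if "y1 \<in> N" "y2 \<in> N" "x \<in> M" "z = x \<otimes> inv y1 \<otimes> inv y2" for x y1 y2 z
  proof -
    have c: "y1 \<in> carrier G" "y2 \<in> carrier G" "x \<in> carrier G"
      using that stable_subgroupD(4) M N by auto
    have "y2 \<otimes> y1 \<in> N"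
      using that stable_subgroupD(1)[OF N] by (simp add: subgroup.m_closed)
    moreover have "x \<otimes> inv (y2 \<otimes> y1) = z"
      using c that(4) by (simp add: inv_mult_group m_assoc)
    ultimately show ?thesis
      by blast
  qed
  have grow: "\<exists>y\<in>N. x \<otimes> inv y \<in> M \<inter> window {- int (k + m)..int (k + m)}"
    if x: "x \<in> M" "x \<in> window {- int k..int k}" for x m
  proof (induction m)
    case 0
    have "x \<otimes> inv \<one> = x"
      using x(2) by (simp add: window_def)
    then show ?case
      using x stable_subgroupD(5)[OF N] by (intro bexI[of _ \<one>]) auto
  next
    case (Suc m)
    then obtain y where y: "y \<in> N" "x \<otimes> inv y \<in> M \<inter> window {- int (k + m)..int (k + m)}"
      by blast
    then obtain y1 where y1: "y1 \<in> N"
      "x \<otimes> inv y \<otimes> inv y1 \<in> M \<inter> window {- int (k + m) - 1..int (k + m)}"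
      using left[of "x \<otimes> inv y" "- int (k + m)" "int (k + m)"] by auto
    then obtain y2 where y2: "y2 \<in> N"
      "x \<otimes> inv y \<otimes> inv y1 \<otimes> inv y2 \<in> M \<inter> window {- int (k + m) - 1..int (k + m) + 1}"
      using right[of "x \<otimes> inv y \<otimes> inv y1" "- int (k + m) - 1" "int (k + m)"] by auto
    obtain y' where y': "y' \<in> N" "x \<otimes> inv y' = x \<otimes> inv y \<otimes> inv y1"
      using mult[OF y(1) y1(1) x(1)] by blast
    obtain y'' where y'': "y'' \<in> N" "x \<otimes> inv y'' = x \<otimes> inv y \<otimes> inv y1 \<otimes> inv y2"
      using mult[OF y'(1) y2(1) x(1)] y'(2) by metis
    have "{- int (k + m) - 1..int (k + m) + 1} = {- int (k + Suc m)..int (k + Suc m)}"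
      by auto
    then show ?case
      using y'' y2(2) by metis
  qed
  have "x \<in> N" if x: "x \<in> M" "x \<in> window {- int k..int k}" for x
  proof (rule ccontr)
    assume xN: "x \<notin> N"
    have xc: "x \<in> carrier G"
      using x(2) by (simp add: window_def)
    \<comment> \<open>As \<open>N\<close> is closed and misses \<open>x\<close>, this is an open
      neighbourhood of the identity. A sufficiently corrected \<open>z = x \<otimes> inv y\<close>
      falls into it, although \<open>inv z \<otimes> x = y\<close> lies in \<open>N\<close>.\<close>
    let ?W = "{z \<in> topspace T. inv z \<otimes> x \<in> carrier G - N}"
    have "openin T (carrier G - N)"
      using stable_subgroupD(2)[OF N] by (simp add: closedin_def topspace_eq_carrier)
    then have "openin T ?W"
      using openin_continuous_map_preimage[OF continuous_map_compose[OF continuous_inv continuous_map_right_translation[OF xc]]]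
      unfolding o_def by blast
    moreover have "\<one> \<in> ?W"
      using xc xN by (simp add: topspace_eq_carrier)
    ultimately obtain m :: nat where m: "window {- int m..int m} \<subseteq> ?W"
      using window_neighbourhood_base by blast
    obtain y where y: "y \<in> N" "x \<otimes> inv y \<in> window {- int (k + m)..int (k + m)}"
      using grow[OF x] by blast
    then have yc: "y \<in> carrier G"
      using stable_subgroupD(4)[OF N] by blast
    have "x \<otimes> inv y \<in> ?W"
      using y(2) m window_antimono[of "{- int m..int m}" "{- int (k + m)..int (k + m)}"] by auto
    moreover have "inv (x \<otimes> inv y) \<otimes> x = y"
      using xc yc by (simp add: inv_mult_group m_assoc)
    ultimately show False
      using y(1) by simp
  qed
  then show ?thesis
    using that by blast
qed

section \<open>Intersections of stable subgroups\<close>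

lemma stable_subgroup_Inter:
  assumes "\<F> \<noteq> {}" "\<And>K. K \<in> \<F> \<Longrightarrow> stable_subgroup K"
  shows "stable_subgroup (\<Inter>\<F>)"
  using assms subgroups_Inter[of \<F>] closedin_Inter[of \<F> T]
  by (auto simp: stable_subgroup_def)

text \<open>Each \<open>K\<close> contains the trace on \<open>H\<close> of a central window, and
  finitely many central windows contain a common one. Intersecting with \<open>H\<close> covers the
  empty family.\<close>

lemma reach_finite_Inter:
  assumes H: "stable_subgroup H" and "finite \<F>"
    and "\<And>K. K \<in> \<F> \<Longrightarrow> stable_subgroup K \<and> K \<subseteq> H \<and> reach K = reach H"
  shows "reach (H \<inter> \<Inter>\<F>) = reach H"
proof -
  have "\<exists>k::nat. H \<inter> window {- int k..int k} \<subseteq> \<Inter>\<F>"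
    using assms(2,3)
  proof (induction \<F>)
    case (insert K \<F>)
    then obtain k where k: "H \<inter> window {- int k..int k} \<subseteq> \<Inter>\<F>"
      by auto
    obtain l where l: "H \<inter> window {- int l..int l} \<subseteq> K"
      using relatively_open_if_reach_eq[OF H, of K] insert.prems by blast
    have "window {- int (max k l)..int (max k l)} \<subseteq> window {- int k..int k} \<inter> window {- int l..int l}"
      by (intro Int_greatest window_antimono) auto
    then have "H \<inter> window {- int (max k l)..int (max k l)} \<subseteq> \<Inter>(insert K \<F>)"
      using k l by blast
    then show ?case
      by blast
  qed auto
  then obtain k where "H \<inter> window {- int k..int k} \<subseteq> H \<inter> \<Inter>\<F>"
    by blast
  moreover have "stable_subgroup (H \<inter> \<Inter>\<F>)"
    using stable_subgroup_Inter[of "insert H \<F>"] assms by auto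
  ultimately show ?thesis
    using reach_eq_if_relatively_open[OF H] by blast
qed

text \<open>A coset in \<open>reach H\<close> has to meet the intersection within the window of
  every ray. Its part in that window is compact, so the finite case and the finite intersection
  property suffice.\<close>

lemma reach_Inter:
  assumes H: "stable_subgroup H" and "\<F> \<noteq> {}"
    and F: "\<And>K. K \<in> \<F> \<Longrightarrow> stable_subgroup K \<and> K \<subseteq> H \<and> reach K = reach H"
  shows "reach (\<Inter>\<F>) = reach H"
proof
  show "reach (\<Inter>\<F>) \<subseteq> reach H"
    using assms(2) F by (intro reach_mono) blast
  show "reach H \<subseteq> reach (\<Inter>\<F>)"
  proof
    fix p assume "p \<in> reach H"
    then obtain s C where C: "p = (s, C)" "(s, C) \<in> reach H"
      by (cases p) auto
    have "C \<in> (\<lambda>x. V #> x) ` (\<Inter>\<F> \<inter> window (ray s k))" for k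
    proof -
      \<comment> \<open>\<open>Suc k\<close> makes the ray nonempty, which gives compactness, and
        only shrinks the window.\<close>
      let ?S = "C \<inter> window (ray s (Suc k))"
      obtain x where x: "x \<in> H" "C = V #> x"
        using C(2) unfolding reach_def by blast
      have xc: "x \<in> carrier G"
        using x(1) stable_subgroupD(4)[OF H] by blast
      have "ray s (Suc k) \<noteq> {}"
        by (auto simp: ray_def)
      then have "compactin T ?S"
        using closedin_r_coset[OF xc V_closed] x(2) by (simp add: closed_Int_compactin compactin_window)
      moreover have "?S \<inter> \<Inter>\<F>' \<noteq> {}" if "finite \<F>'" "\<F>' \<subseteq> \<F>" for \<F>'
      proof -
        have "reach (H \<inter> \<Inter>\<F>') = reach H"
          using reach_finite_Inter[OF H that(1)] F that(2) by blast
        then have "C \<in> (\<lambda>x. V #> x) ` (H \<inter> \<Inter>\<F>' \<inter> window (ray s (Suc k)))"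
          using C(2) unfolding reach_def by blast
        then obtain y where y: "y \<in> H \<inter> \<Inter>\<F>' \<inter> window (ray s (Suc k))" "C = V #> y"
          by blast
        then have "y \<in> C"
          using rcos_self[OF _ V_subgroup] stable_subgroupD(4)[OF H] by blast
        then show ?thesis
          using y by blast
      qed
      ultimately have "?S \<inter> \<Inter>\<F> \<noteq> {}"
        using F unfolding compactin_fip stable_subgroup_def by blast
      then obtain y where y: "y \<in> C" "y \<in> window (ray s (Suc k))" "y \<in> \<Inter>\<F>"
        by blast
      then have "C = V #> y"
        using x(2) repr_independence[OF _ xc V_subgroup] by blast
      then show ?thesis
        using y window_antimono[OF ray_mono, of k "Suc k" s] by auto
    qed
    then show "p \<in> reach (\<Inter>\<F>)"
      unfolding C(1) reach_def by blast
  qed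
qed

end

section \<open>Subnormal chains\<close>

context topological_group
begin

text \<open>When \<open>B\<close> is a normal subgroup of \<open>A\<close>, this is the closure of
  \<open>[A, A] B\<close>, formed without a product set.\<close>

definition closed_derived :: "'a set \<Rightarrow> 'a set \<Rightarrow> 'a set" where
  "closed_derived A B = T closure_of (generate G (derived_set G A \<union> B))"

lemma conjugation_group_hom:
  assumes "a \<in> carrier G"
  shows "group_hom G G (\<lambda>x. a \<otimes> x \<otimes> inv a)"
proof (unfold_locales, rule homI)
  fix x y assume "x \<in> carrier G" "y \<in> carrier G"
  moreover from this have "inv a \<otimes> (a \<otimes> (y \<otimes> inv a)) = y \<otimes> inv a"
    using assms by (simp flip: m_assoc)
  ultimately show "a \<otimes> (x \<otimes> y) \<otimes> inv a = a \<otimes> x \<otimes> inv a \<otimes> (a \<otimes> y \<otimes> inv a)"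
    using assms by (simp add: m_assoc)
qed (use assms in auto)

lemma
  assumes A: "subgroup A G" "closedin T A" and "B \<subseteq> A"
  shows closed_derived_subgroup: "subgroup (closed_derived A B) G"
    and closedin_closed_derived: "closedin T (closed_derived A B)"
    and closed_derived_subset: "closed_derived A B \<subseteq> A"
    and derived_set_subset_closed_derived: "derived_set G A \<subseteq> closed_derived A B"
    and subset_closed_derived: "B \<subseteq> closed_derived A B"
proof -
  let ?S = "derived_set G A \<union> B"
  have S: "?S \<subseteq> A"
    using derived_set_incl[OF order_refl A(1)] assms(3) by blast
  then have Sc: "?S \<subseteq> carrier G"
    using A(1) subgroup.subset by blast
  have gen: "subgroup (generate G ?S) G"
    using Sc by (rule generate_is_subgroup)
  then show "subgroup (closed_derived A B) G"
    unfolding closed_derived_def by (rule subgroup_closure_of)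
  show "closedin T (closed_derived A B)"
    unfolding closed_derived_def by simp
  show "closed_derived A B \<subseteq> A"
    unfolding closed_derived_def
    using generate_subgroup_incl[OF S A(1)] A(2) by (rule closure_of_minimal)
  have "?S \<subseteq> generate G ?S"
    by (auto intro: generate.incl)
  also have "\<dots> \<subseteq> closed_derived A B"
    unfolding closed_derived_def
    using subgroup.subset[OF gen] by (simp add: closure_of_subset topspace_eq_carrier)
  finally show "derived_set G A \<subseteq> closed_derived A B" "B \<subseteq> closed_derived A B"
    by blast+
qed

text \<open>A homomorphism preserving \<open>A\<close> maps commutators of \<open>A\<close> to
  commutators of \<open>A\<close>, and continuity carries the inclusion over to closures. The lemma
  serves the iterates and the conjugations alike.\<close>

lemma closed_derived_invariant:
  assumes f: "group_hom G G f" "continuous_map T T f"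
    and AB: "A \<subseteq> carrier G" "f ` A \<subseteq> A" "B \<subseteq> carrier G" "f ` B \<subseteq> B"
  shows "f ` closed_derived A B \<subseteq> closed_derived A B"
proof -
  interpret f: group_hom G G f
    by (rule f)
  let ?S = "derived_set G A \<union> B"
  have "f ` derived_set G A \<subseteq> derived_set G A"
  proof
    fix y assume "y \<in> f ` derived_set G A"
    then obtain a b where ab: "a \<in> A" "b \<in> A" "y = f (a \<otimes> b \<otimes> inv a \<otimes> inv b)"
      by blast
    then have "y = f a \<otimes> f b \<otimes> inv (f a) \<otimes> inv (f b)"
      using AB(1) by (simp add: subset_iff)
    moreover have "f a \<in> A" "f b \<in> A"
      using AB(2) ab by blast+
    ultimately show "y \<in> derived_set G A"
      by blast
  qed
  then have "f ` ?S \<subseteq> ?S"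
    using AB(4) by (simp only: image_Un Un_mono)
  then have "generate G (f ` ?S) \<subseteq> generate G ?S"
    by (rule mono_generate)
  moreover have "generate G (f ` ?S) = f ` generate G ?S"
    using f.generate_img[of ?S] derived_set_in_carrier[OF AB(1)] AB(3) by simp
  ultimately have "f ` generate G ?S \<subseteq> generate G ?S"
    by simp
  then show ?thesis
    unfolding closed_derived_def
    using continuous_map_image_closure_subset[OF f(2)] closure_of_mono by (meson order_trans)
qed

end

section \<open>Refinement of subnormal chains\<close>

context expansive_system
begin

definition normal_step :: "'a set \<Rightarrow> 'a set \<Rightarrow> bool" where
  "normal_step A B \<longleftrightarrow> stable_subgroup A \<and> stable_subgroup B \<and> B \<subseteq> A \<and>
     (\<forall>a\<in>A. \<forall>b\<in>B. a \<otimes> b \<otimes> inv a \<in> B)"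

text \<open>The properties of the quotient are encoded by \<open>reach\<close>: the second clause
  says that \<open>K/B\<close> is discrete or open in \<open>A/B\<close>, the third that
  \<open>A/B\<close> is discrete, abelian or topologically perfect.\<close>

definition simple_step :: "'a set \<Rightarrow> 'a set \<Rightarrow> bool" where
  "simple_step A B \<longleftrightarrow> normal_step A B \<and>
     (\<forall>K. normal_step A K \<longrightarrow> B \<subseteq> K \<longrightarrow> reach K = reach B \<or> reach K = reach A) \<and>
     (reach A = reach B \<or> derived_set G A \<subseteq> B \<or> closed_derived A B = A)"

text \<open>
  Tightness quantifies over subnormal \<open>K\<close> so that it is inherited by the pieces of a refined chain: a
  normal subgroup of a member of the chain need not be normal in \<open>A\<close>.
\<close>

definition tight :: "'a set \<Rightarrow> 'a set \<Rightarrow> bool" where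
  "tight A B \<longleftrightarrow>
     (\<forall>K. normal_step\<^sup>*\<^sup>* A K \<longrightarrow> normal_step\<^sup>*\<^sup>* K B \<longrightarrow> reach K = reach B \<or> reach K = reach A)"

lemma normal_stepD:
  assumes "normal_step A B"
  shows "stable_subgroup A" "stable_subgroup B" "B \<subseteq> A"
    "a \<in> A \<Longrightarrow> b \<in> B \<Longrightarrow> a \<otimes> b \<otimes> inv a \<in> B"
  using assms by (auto simp: normal_step_def)

lemma subnormal_subset: "normal_step\<^sup>*\<^sup>* A B \<Longrightarrow> B \<subseteq> A"
  by (induction rule: rtranclp_induct) (auto simp: normal_step_def)

text \<open>Along \<open>A\<close>, \<open>A'\<close>, \<open>K\<close>, \<open>B'\<close>,
  \<open>B\<close> the values of \<open>reach\<close> decrease, and each is one of the two extreme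
  ones. Hence \<open>K\<close> agrees with \<open>A'\<close> or with \<open>B'\<close>.\<close>

lemma tight_mono:
  assumes "tight A B" "normal_step\<^sup>*\<^sup>* A A'" "normal_step\<^sup>*\<^sup>* A' B'" "normal_step\<^sup>*\<^sup>* B' B"
  shows "tight A' B'"
  unfolding tight_def
proof (intro allI impI)
  fix K assume K: "normal_step\<^sup>*\<^sup>* A' K" "normal_step\<^sup>*\<^sup>* K B'"
  have *: "reach L = reach B \<or> reach L = reach A" if "normal_step\<^sup>*\<^sup>* A L" "normal_step\<^sup>*\<^sup>* L B" for L
    using assms(1) that unfolding tight_def by blast
  note AB' = rtranclp_trans[OF assms(2,3)] and A'B = rtranclp_trans[OF assms(3,4)]
  have "reach K = reach B \<or> reach K = reach A" "reach A' = reach B \<or> reach A' = reach A"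
    "reach B' = reach B \<or> reach B' = reach A"
    using *[OF rtranclp_trans[OF assms(2) K(1)] rtranclp_trans[OF K(2) assms(4)]]
      *[OF assms(2) A'B] *[OF AB' assms(4)] by simp_all
  moreover have "reach B \<subseteq> reach B'" "reach B' \<subseteq> reach K" "reach K \<subseteq> reach A'" "reach A' \<subseteq> reach A"
    using assms K by (simp_all add: subnormal_subset reach_mono)
  ultimately show "reach K = reach B' \<or> reach K = reach A'"
    by blast
qed

lemma normal_step_weaken:
  assumes "normal_step A B" "normal_step A K" "B \<subseteq> K"
  shows "normal_step K B"
  using assms by (auto simp: normal_step_def)

lemma simple_step_if_tight:
  assumes "tight A B" "normal_step A B"
    "reach A = reach B \<or> derived_set G A \<subseteq> B \<or> closed_derived A B = A"
  shows "simple_step A B"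
proof -
  have "reach K = reach B \<or> reach K = reach A" if "normal_step A K" "B \<subseteq> K" for K
    using assms(1) that(1) normal_step_weaken[OF assms(2) that] unfolding tight_def by blast
  then show ?thesis
    using assms(2,3) unfolding simple_step_def by blast
qed

text \<open>The iterates, and the conjugations by elements of \<open>A\<close>, are continuous
  endomorphisms that preserve both \<open>P\<close> and \<open>N\<close>.\<close>

lemma normal_step_closed_derived:
  assumes "normal_step A P" "normal_step A N" "N \<subseteq> P"
  shows "normal_step A (closed_derived P N)"
proof -
  note A = stable_subgroupD[OF normal_stepD(1)[OF assms(1)]]
  note P = stable_subgroupD[OF normal_stepD(2)[OF assms(1)]]
  note N = stable_subgroupD[OF normal_stepD(2)[OF assms(2)]]
  note D = closed_derived_subgroup[OF P(1,2) assms(3)] closedin_closed_derived[OF P(1,2) assms(3)]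
    closed_derived_subset[OF P(1,2) assms(3)]
  have "\<phi> i ` closed_derived P N \<subseteq> closed_derived P N" for i
    using closed_derived_invariant[OF iter_group_hom iter_continuous P(4) _ N(4)] P(3) N(3)
    by (metis image_subsetI)
  moreover have "(\<lambda>x. a \<otimes> x \<otimes> inv a) ` closed_derived P N \<subseteq> closed_derived P N" if "a \<in> A" for a
    using closed_derived_invariant[OF conjugation_group_hom continuous_map_conjugation P(4) _ N(4), of a]
      normal_stepD(4)[OF assms(1) that] normal_stepD(4)[OF assms(2) that] that A(4)
    by (metis (no_types, lifting) image_subsetI subsetD)
  ultimately show ?thesis
    using D normal_stepD[OF assms(1)] by (auto simp: normal_step_def stable_subgroup_def image_subset_iff)
qed

text \<open>The chain is \<open>A\<close>, \<open>P\<close>, \<open>D\<close>, \<open>N\<close>, or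
  just \<open>A\<close>, \<open>P\<close>, \<open>N\<close> if \<open>D\<close> has the same reach
  as \<open>A\<close>. Here \<open>P\<close> is the least member of \<open>\<F>\<close>.\<close>

lemma simple_chain_of_tight_step:
  assumes tight: "tight A N" and AN: "normal_step A N"
  shows "simple_step\<^sup>*\<^sup>* A N"
proof -
  note A = normal_stepD(1)[OF AN]
  define \<F> where "\<F> = {K. normal_step A K \<and> N \<subseteq> K \<and> reach K = reach A}"
  define P where "P = \<Inter>\<F>"
  define D where "D = closed_derived P N"
  have "normal_step A A"
    using A stable_subgroupD(1,4)[OF A]
    by (auto simp: normal_step_def subgroup.m_closed subgroup.m_inv_closed)
  then have AF: "A \<in> \<F>"
    unfolding \<F>_def using normal_stepD(3)[OF AN] by blast
  have "reach P = reach A"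
    unfolding P_def using AF by (intro reach_Inter[OF A]) (auto simp: \<F>_def normal_step_def)
  moreover have "stable_subgroup P"
    unfolding P_def using AF by (intro stable_subgroup_Inter) (auto simp: \<F>_def normal_step_def)
  moreover have "a \<otimes> x \<otimes> inv a \<in> P" if "a \<in> A" "x \<in> P" for a x
    using that unfolding P_def \<F>_def normal_step_def by blast
  ultimately have P: "normal_step A P" "reach P = reach A" "N \<subseteq> P"
    using A AF unfolding normal_step_def by (auto simp: P_def \<F>_def)
  have D: "normal_step A D" "N \<subseteq> D" "D \<subseteq> P" "derived_set G P \<subseteq> D"
    unfolding D_def using normal_step_closed_derived[OF P(1) AN P(3)]
      stable_subgroupD(1,2)[OF normal_stepD(2)[OF P(1)]] P(3)
    by (simp_all add: closed_derived_subset derived_set_subset_closed_derived subset_closed_derived)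
  note steps = P(1) normal_step_weaken[OF D(1) P(1) D(3)] normal_step_weaken[OF AN P(1,3)]
    normal_step_weaken[OF AN D(1,2)]
  have AP: "simple_step A P"
    using tight_mono[OF tight] steps P(2) by (intro simple_step_if_tight) auto
  have "reach D = reach N \<or> reach D = reach A"
    using tight D(1) steps(4) unfolding tight_def by blast
  then show ?thesis
  proof
    \<comment> \<open>In this case \<open>P/D\<close> is abelian, as \<open>D\<close> contains the
      commutators of \<open>P\<close>, and \<open>D/N\<close> is discrete.\<close>
    assume DN: "reach D = reach N"
    have "normal_step\<^sup>*\<^sup>* A D" "normal_step\<^sup>*\<^sup>* P N"
      using D(1) steps by auto
    then have "simple_step P D"
      using tight_mono[OF tight, of P D] steps D(4)
      by (intro simple_step_if_tight) auto
    moreover have "simple_step D N"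
      using tight_mono[OF tight \<open>normal_step\<^sup>*\<^sup>* A D\<close>, of N] steps DN
      by (intro simple_step_if_tight) auto
    ultimately show ?thesis
      using AP by (meson rtranclp.rtrancl_into_rtrancl r_into_rtranclp)
  next
    assume "reach D = reach A"
    \<comment> \<open>Membership in the family whose intersection is \<open>P\<close> forces
      \<open>D = P\<close>.\<close>
    then have "D \<in> \<F>"
      using D unfolding \<F>_def by blast
    then have "closed_derived P N = P"
      using D(3) unfolding P_def D_def by blast
    then have "simple_step P N"
      using tight_mono[OF tight, of P N] steps by (intro simple_step_if_tight) auto
    then show ?thesis
      using AP by (meson rtranclp.rtrancl_into_rtrancl r_into_rtranclp)
  qed
qed

text \<open>Tightness passes to each consecutive pair of the chain, so the steps can be refined
  separately.\<close>

lemma simple_chain_of_tight: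
  assumes "normal_step\<^sup>*\<^sup>* A B" "tight A B"
  shows "simple_step\<^sup>*\<^sup>* A B"
  using assms
proof (induction rule: converse_rtranclp_induct)
  case (step A A')
  have "tight A A'"
    using tight_mono[OF step.prems] step.hyps by blast
  moreover have "tight A' B"
    using tight_mono[OF step.prems] step.hyps by blast
  ultimately show ?case
    using simple_chain_of_tight_step step by (meson rtranclp_trans)
qed auto

text \<open>If tightness fails, some intermediate \<open>K\<close> has a reach strictly between
  those of the ends. Splitting there shrinks the finite set \<open>reach A - reach B\<close> for
  both halves.\<close>

lemma simple_chain_of_subnormal:
  assumes "normal_step\<^sup>*\<^sup>* A B"
  shows "simple_step\<^sup>*\<^sup>* A B"
  using assms
proof (induction "card (reach A - reach B)" arbitrary: A B rule: less_induct)
  case less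
  show ?case
  proof (cases "tight A B")
    case True
    then show ?thesis
      using less.prems simple_chain_of_tight by blast
  next
    case False
    then obtain K where K: "normal_step\<^sup>*\<^sup>* A K" "normal_step\<^sup>*\<^sup>* K B"
      "reach K \<noteq> reach B" "reach K \<noteq> reach A"
      unfolding tight_def by blast
    then have "reach B \<subset> reach K" "reach K \<subset> reach A"
      using reach_mono subnormal_subset by blast+
    then have "reach A - reach K \<subset> reach A - reach B" "reach K - reach B \<subset> reach A - reach B"
      by blast+
    then have "card (reach A - reach K) < card (reach A - reach B)"
      "card (reach K - reach B) < card (reach A - reach B)"
      by (simp_all add: psubset_card_mono finite_reach)
    then show ?thesis
      using less.hyps K(1,2) by (meson rtranclp_trans)
  qed
qed

lemma simple_chain_exists: "simple_step\<^sup>*\<^sup>* (carrier G) {\<one>}"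
proof (rule simple_chain_of_subnormal, rule r_into_rtranclp)
  have "closedin T {\<one>}"
    using Hausdorff by (simp add: closedin_Hausdorff_sing_eq topspace_eq_carrier)
  moreover have "closedin T (carrier G)"
    using closedin_topspace[of T] by (simp add: topspace_eq_carrier)
  ultimately show "normal_step (carrier G) {\<one>}"
    using subgroup_self triv_subgroup
    by (auto simp: normal_step_def stable_subgroup_def iter_one iter_closed)
qed

end

section \<open>Quotients\<close>

context topological_group
begin

text \<open>\<open>K\<close> is the trace on \<open>A\<close> of the union of the translates of
  \<open>W\<close> by elements of \<open>K\<close>.\<close>

lemma openin_subtopology_subgroup:
  assumes "subgroup A G" "subgroup K G" "K \<subseteq> A" "openin T W" "\<one> \<in> W" "A \<inter> W \<subseteq> K"
  shows "openin (subtopology T A) K"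
proof -
  note A = subgroup.m_closed[OF assms(1)] subgroup.m_inv_closed[OF assms(1)]
    subgroup.mem_carrier[OF assms(1)]
  have Kc: "K \<subseteq> carrier G"
    using subgroup.subset[OF assms(2)] .
  have "K = (\<Union>x\<in>K. W #> x) \<inter> A"
  proof
    have "x \<in> W #> x" if "x \<in> K" for x
      using that Kc assms(5) by (force simp: r_coset_def)
    then show "K \<subseteq> (\<Union>x\<in>K. W #> x) \<inter> A"
      using assms(3) by blast
    show "(\<Union>x\<in>K. W #> x) \<inter> A \<subseteq> K"
    proof
      fix y assume "y \<in> (\<Union>x\<in>K. W #> x) \<inter> A"
      then obtain x where x: "x \<in> K" "y \<in> W #> x" "y \<in> A"
        by blast
      then have c: "x \<in> carrier G" "y \<in> carrier G" "x \<in> A"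
        using Kc A(3) assms(3) by auto
      have "y \<otimes> inv x \<in> W"
        using x(2) r_coset_eq_vimage[OF c(1) openin_carrier[OF assms(4)]] by simp
      then have "y \<otimes> inv x \<in> K"
        using A(1,2) x(3) c(3) assms(6) by blast
      then have "y \<otimes> inv x \<otimes> x \<in> K"
        using x(1) subgroup.m_closed[OF assms(2)] by blast
      then show "y \<in> K"
        using c by (simp add: m_assoc)
    qed
  qed
  moreover have "openin T (\<Union>x\<in>K. W #> x)"
    using openin_r_coset assms(4) Kc by blast
  ultimately show ?thesis
    unfolding openin_subtopology by blast
qed

end

locale closed_normal_pair = topological_group G T for G (structure) and T :: "'a topology" +
  fixes A B :: "'a set"
  assumes A_subgroup: "subgroup A G" and A_closed: "closedin T A"
    and B_subgroup: "subgroup B G" and B_subset: "B \<subseteq> A"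
    and B_normal: "a \<in> A \<Longrightarrow> b \<in> B \<Longrightarrow> a \<otimes> b \<otimes> inv a \<in> B"
begin

abbreviation (input) H where "H \<equiv> G\<lparr>carrier := A\<rparr>"
abbreviation (input) Q where "Q \<equiv> H Mod B"
abbreviation (input) TQ where "TQ \<equiv> quotient_topology H (subtopology T A) B"

lemma A_carrier: "A \<subseteq> carrier G"
  using A_subgroup subgroup.subset by blast

lemma B_normal_H: "B \<lhd> H"
proof -
  interpret H: group H
    using A_subgroup by (rule subgroup_imp_group)
  have "subgroup B H"
    using subgroup_incl[OF B_subgroup A_subgroup B_subset] .
  then show ?thesis
    using B_normal m_inv_consistent[OF A_subgroup] by (simp add: H.normal_inv_iff)
qed

lemma carrier_Q: "carrier Q = (\<lambda>x. B #> x) ` A"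
  by (simp add: carrier_FactGroup)

lemma group_hom_Q: "group_hom H Q (\<lambda>x. B #> x)"
proof -
  interpret normal B H
    by (rule B_normal_H)
  show ?thesis
    using group_hom.intro[OF is_group factorgroup_is_group] r_coset_hom_Mod
    unfolding group_hom_axioms_def by simp
qed

lemma topspace_TQ: "topspace TQ = carrier Q"
  using A_carrier by (intro topspace_quotient_topology) (auto simp: topspace_eq_carrier)

lemma openin_TQ: "openin TQ U \<longleftrightarrow> U \<subseteq> carrier Q \<and> openin (subtopology T A) {x \<in> A. B #> x \<in> U}"
  by (simp add: openin_quotient_topology)

lemma closedin_preimage_TQ:
  assumes "closedin TQ C"
  shows "closedin T {x \<in> A. B #> x \<in> C}"
proof -
  have top: "topspace (subtopology T A) = A"
    using A_carrier by (auto simp: topspace_eq_carrier)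
  have "continuous_map (subtopology T A) TQ (\<lambda>x. B #> x)"
    using quotient_map_quotient_topology[of "subtopology T A" H B] top
    by (simp add: quotient_imp_continuous_map)
  from closedin_continuous_map_preimage[OF this assms]
  have "closedin (subtopology T A) {x \<in> A. B #> x \<in> C}"
    by (simp only: top)
  then show ?thesis
    using A_closed closedin_closed_subtopology by blast
qed

text \<open>The topology on \<open>K/B\<close> is induced from \<open>A/B\<close>, so each point
  needs an isolating open set of \<open>A/B\<close>. The image of \<open>A \<inter> (W #> x)\<close>
  meets \<open>K/B\<close> only in the coset of \<open>x\<close>.\<close>

lemma discrete_image_TQ:
  assumes "K \<subseteq> A" "subgroup K G" "B \<subseteq> K" "openin T W" "\<one> \<in> W" "K \<inter> W \<subseteq> B"
  shows "subtopology TQ ((\<lambda>x. B #> x) ` K) = discrete_topology ((\<lambda>x. B #> x) ` K)"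
proof -
  let ?N = "(\<lambda>x. B #> x) ` K"
  note A = subgroup.m_closed[OF A_subgroup] subgroup.m_inv_closed[OF A_subgroup]
    subgroup.mem_carrier[OF A_subgroup]
  have "openin (subtopology TQ ?N) {q}" if q: "q \<in> ?N" for q
  proof -
    obtain x where x: "x \<in> K" "q = B #> x"
      using q by blast
    have xc: "x \<in> carrier G" "x \<in> A"
      using x(1) assms(1) A_carrier by auto
    define U where "U = (\<lambda>y. B #> y) ` (A \<inter> (W #> x))"
    \<comment> \<open>The preimage of \<open>U\<close> is the trace on \<open>A\<close> of the
      saturation of \<open>W #> x\<close> under left multiplication by \<open>B\<close>, a union of
      open translates.\<close>
    have eq: "{y \<in> A. B #> y \<in> U} = (\<Union>b\<in>B. {y \<in> topspace T. b \<otimes> y \<in> W #> x}) \<inter> A"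
    proof safe
      fix y assume y: "y \<in> A" "B #> y \<in> U"
      then obtain z where z: "z \<in> A" "z \<in> W #> x" "B #> y = B #> z"
        unfolding U_def by blast
      have c: "y \<in> carrier G" "z \<in> carrier G"
        using y(1) z(1) A_carrier by auto
      have "z \<otimes> inv y \<in> B"
        using z(3) r_coset_eq_iff[OF B_subgroup c(2,1)] by simp
      moreover have "z \<otimes> inv y \<otimes> y = z"
        using c by (simp add: m_assoc)
      ultimately show "y \<in> (\<Union>b\<in>B. {y \<in> topspace T. b \<otimes> y \<in> W #> x})"
        using z(2) c by (auto simp: topspace_eq_carrier intro!: bexI[of _ "z \<otimes> inv y"])
    next
      fix y b assume y: "y \<in> A" "b \<in> B" "b \<otimes> y \<in> W #> x"
      have c: "b \<in> carrier G" "y \<in> carrier G" "b \<in> A"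
        using y(1,2) A_carrier B_subset by auto
      have "b \<otimes> y \<otimes> inv y \<in> B"
        using c y(2) by (simp add: m_assoc)
      then have "B #> (b \<otimes> y) = B #> y"
        using r_coset_eq_iff[OF B_subgroup, of "b \<otimes> y" y] c by simp
      then show "B #> y \<in> U"
        unfolding U_def using y A(1)[OF c(3) y(1)] by (intro image_eqI[of _ _ "b \<otimes> y"]) auto
    qed
    have "openin T {y \<in> topspace T. b \<otimes> y \<in> W #> x}" if "b \<in> B" for b
      using that B_subset A_carrier openin_r_coset[OF xc(1) assms(4)]
      by (intro openin_continuous_map_preimage[OF continuous_map_left_translation]) auto
    then have "openin T (\<Union>b\<in>B. {y \<in> topspace T. b \<otimes> y \<in> W #> x})"
      by (intro openin_Union) blast
    then have "openin (subtopology T A) {y \<in> A. B #> y \<in> U}"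
      unfolding eq openin_subtopology by blast
    moreover have "U \<subseteq> carrier Q"
      unfolding carrier_Q U_def by blast
    ultimately have "openin TQ U"
      unfolding openin_TQ by blast
    moreover have "U \<inter> ?N = {q}"
    proof
      have "x \<in> W #> x"
        using xc(1) assms(5) by (force simp: r_coset_def)
      then show "{q} \<subseteq> U \<inter> ?N"
        using x xc(2) unfolding U_def by blast
      show "U \<inter> ?N \<subseteq> {q}"
      proof
        fix p assume "p \<in> U \<inter> ?N"
        then obtain y z where y: "y \<in> A" "y \<in> W #> x" "p = B #> y" and z: "z \<in> K" "p = B #> z"
          unfolding U_def by blast
        have c: "y \<in> carrier G" "z \<in> carrier G"
          using y(1) z(1) assms(1) A_carrier by auto
        \<comment> \<open>Since \<open>y\<close> differs from an element of \<open>K\<close> by one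
          of \<open>B\<close>, it lies in \<open>K\<close>; then \<open>y \<otimes> inv x\<close>
          lies in \<open>K \<inter> W\<close>, hence in \<open>B\<close>.\<close>
        have "y \<otimes> inv z \<in> B"
          using y(3) z(2) r_coset_eq_iff[OF B_subgroup c] by simp
        then have "y \<otimes> inv z \<otimes> z \<in> K"
          using assms(3) z(1) subgroup.m_closed[OF assms(2)] by blast
        then have "y \<in> K"
          using c by (simp add: m_assoc)
        then have "y \<otimes> inv x \<in> K"
          using x(1) by (simp add: subgroup.m_closed[OF assms(2)] subgroup.m_inv_closed[OF assms(2)])
        moreover have "y \<otimes> inv x \<in> W"
          using y(2) r_coset_eq_vimage[OF xc(1) openin_carrier[OF assms(4)]] by simp
        ultimately have "B #> y = B #> x"
          using assms(6) r_coset_eq_iff[OF B_subgroup c(1) xc(1)] by blast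
        then show "p \<in> {q}"
          using y(3) x(2) by simp
      qed
    qed
    ultimately show ?thesis
      unfolding openin_subtopology by blast
  qed
  moreover have "topspace (subtopology TQ ?N) = ?N"
    using assms(1) by (auto simp: topspace_TQ carrier_Q)
  ultimately show ?thesis
    by (metis discrete_topology_unique)
qed

lemma comm_group_Q:
  assumes "derived_set G A \<subseteq> B"
  shows "comm_group Q"
proof -
  interpret f: group_hom H Q "\<lambda>x. B #> x"
    by (rule group_hom_Q)
  show ?thesis
  proof (rule f.H.group_comm_groupI)
    fix p q assume "p \<in> carrier Q" "q \<in> carrier Q"
    then obtain x y where xy: "x \<in> A" "y \<in> A" "p = B #> x" "q = B #> y"
      unfolding carrier_Q by blast
    have c: "x \<in> carrier G" "y \<in> carrier G"
      using xy A_carrier by auto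
    have "x \<otimes> y \<otimes> inv (y \<otimes> x) = x \<otimes> y \<otimes> inv x \<otimes> inv y"
      using c by (simp add: inv_mult_group m_assoc)
    then have "x \<otimes> y \<otimes> inv (y \<otimes> x) \<in> B"
      using assms xy(1,2) by blast
    then have "B #> (x \<otimes> y) = B #> (y \<otimes> x)"
      using r_coset_eq_iff[OF B_subgroup] c by simp
    then show "p \<otimes>\<^bsub>Q\<^esub> q = q \<otimes>\<^bsub>Q\<^esub> p"
      using xy f.hom_mult[of x y] f.hom_mult[of y x] by simp
  qed
qed

text \<open>The preimage \<open>?K\<close> of the closed commutator group of \<open>A/B\<close> is
  closed and contains the subgroup generated by \<open>B\<close> and the commutators of
  \<open>A\<close>. Hence it contains \<open>closed_derived A B\<close>, which is
  \<open>A\<close>.\<close>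

lemma topologically_perfect_Q:
  assumes "closed_derived A B = A"
  shows "topologically_perfect Q TQ"
proof -
  interpret f: group_hom H Q "\<lambda>x. B #> x"
    by (rule group_hom_Q)
  let ?f = "\<lambda>x. B #> x"
  let ?D = "derived Q (carrier Q)"
  let ?K = "{x \<in> A. B #> x \<in> TQ closure_of ?D}"
  let ?S = "derived_set G A \<union> B"
  have S: "?S \<subseteq> A"
    using derived_set_incl[OF order_refl A_subgroup] B_subset by blast
  have D: "subgroup ?D Q"
    by (rule f.H.derived_is_subgroup) simp
  have "?f ` derived_set G A \<subseteq> ?D"
  proof -
    have "?f ` derived_set H A \<subseteq> ?f ` derived H A"
      unfolding derived_def by (intro image_mono) (auto intro: generate.incl)
    also have "\<dots> = derived Q (?f ` A)"
      using f.derived_img[of A] by simp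
    finally show ?thesis
      using derived_set_consistent[OF order_refl A_subgroup] by (simp add: carrier_Q)
  qed
  moreover have "?f ` B \<subseteq> ?D"
  proof -
    have "?f b = \<one>\<^bsub>Q\<^esub>" if "b \<in> B" for b
      using coset_join2[OF _ B_subgroup that] that subgroup.mem_carrier[OF B_subgroup that] by simp
    then show ?thesis
      using subgroup.one_closed[OF D] by auto
  qed
  ultimately have "generate Q (?f ` ?S) \<subseteq> ?D"
    using f.H.generate_subgroup_incl[OF _ D] by (simp add: image_Un)
  moreover have "generate Q (?f ` ?S) = ?f ` generate G ?S"
    using f.generate_img[of ?S] S generate_consistent[OF S A_subgroup] by simp
  moreover have "?D \<subseteq> TQ closure_of ?D"
    using subgroup.subset[OF D] topspace_TQ by (simp add: closure_of_subset)
  moreover have "generate G ?S \<subseteq> A"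
    using S A_subgroup by (rule generate_subgroup_incl)
  ultimately have "generate G ?S \<subseteq> ?K"
    by blast
  moreover have "closedin T ?K"
    by (rule closedin_preimage_TQ) simp
  ultimately have "closed_derived A B \<subseteq> ?K"
    unfolding closed_derived_def by (rule closure_of_minimal)
  then have "A \<subseteq> ?K"
    by (simp only: assms)
  then have "carrier Q \<subseteq> TQ closure_of ?D"
    unfolding carrier_Q by blast
  then show ?thesis
    unfolding topologically_perfect_def using closure_of_subset_topspace[of TQ ?D] topspace_TQ by blast
qed

lemma
  assumes "N \<lhd> Q"
  defines "K \<equiv> {x \<in> A. B #> x \<in> N}"
  shows preimage_subgroup: "subgroup K G"
    and preimage_normal: "a \<in> A \<Longrightarrow> x \<in> K \<Longrightarrow> a \<otimes> x \<otimes> inv a \<in> K"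
    and subset_preimage: "B \<subseteq> K"
    and image_preimage: "(\<lambda>x. B #> x) ` K = N"
proof -
  interpret f: group_hom H Q "\<lambda>x. B #> x"
    by (rule group_hom_Q)
  interpret N: normal N Q
    by (rule assms(1))
  note A = subgroup.m_closed[OF A_subgroup] subgroup.m_inv_closed[OF A_subgroup]
    subgroup.one_closed[OF A_subgroup] m_inv_consistent[OF A_subgroup]
  have mult: "B #> (x \<otimes> y) = (B #> x) \<otimes>\<^bsub>Q\<^esub> (B #> y)" if "x \<in> A" "y \<in> A" for x y
    using f.hom_mult[of x y] that by simp
  have inv: "B #> (inv x) = inv\<^bsub>Q\<^esub> (B #> x)" if "x \<in> A" for x
    using f.hom_inv[of x] that A(4) by simp
  have in_carrier: "B #> x \<in> carrier Q" if "x \<in> A" for x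
    using that unfolding carrier_Q by blast
  show "B \<subseteq> K"
  proof
    fix b assume b: "b \<in> B"
    then have "B #> b = \<one>\<^bsub>Q\<^esub>"
      using coset_join2[OF _ B_subgroup b] subgroup.mem_carrier[OF B_subgroup b] by simp
    then show "b \<in> K"
      using b B_subset N.one_closed unfolding K_def by auto
  qed
  show "subgroup K G"
  proof (rule subgroupI)
    show "K \<subseteq> carrier G"
      using A_carrier unfolding K_def by blast
    show "K \<noteq> {}"
      using \<open>B \<subseteq> K\<close> subgroup.one_closed[OF B_subgroup] by blast
    show "inv x \<in> K" if "x \<in> K" for x
      using that A(2) N.m_inv_closed unfolding K_def by (simp add: inv)
    show "x \<otimes> y \<in> K" if "x \<in> K" "y \<in> K" for x y
      using that A(1) N.m_closed unfolding K_def by (simp add: mult)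
  qed
  show "a \<otimes> x \<otimes> inv a \<in> K" if "a \<in> A" "x \<in> K" for a x
    using that A(1,2) N.inv_op_closed2[of "B #> a" "B #> x"] in_carrier[OF that(1)] unfolding K_def
    by (simp add: mult inv)
  show "(\<lambda>x. B #> x) ` K = N"
    using N.subset unfolding K_def carrier_Q by auto
qed

end

section \<open>From \<open>reach\<close> back to quotient groups\<close>

context expansive_system
begin

lemma openin_window: "openin T (window {- int k..int k})"
proof -
  have "window {- int k..int k} = (\<Inter>i\<in>{- int k..int k}. {x \<in> topspace T. \<phi> i x \<in> V})"
    by (auto simp: window_def topspace_eq_carrier)
  then show ?thesis
    using openin_continuous_map_preimage[OF iter_continuous V_open]
    by (simp only:) (intro openin_INT2, auto)
qed

lemma one_in_window: "\<one> \<in> window J"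
  by (simp add: window_def iter_one subgroup.one_closed[OF V_subgroup])

lemma iter_invariantI:
  assumes "K \<subseteq> carrier G" "\<And>x. x \<in> K \<Longrightarrow> \<phi> 1 x \<in> K" "\<And>x. x \<in> K \<Longrightarrow> \<phi> (-1) x \<in> K" "x \<in> K"
  shows "\<phi> i x \<in> K"
proof (induction i rule: int_induct[where k = 0])
  case base
  then show ?case
    using assms(1,4) iter_zero by auto
next
  case (step1 i)
  have "\<phi> (i + 1) x = \<phi> 1 (\<phi> i x)"
    using assms(1,4) by (auto simp: iter_add add.commute)
  then show ?case
    using assms(2) step1 by simp
next
  case (step2 i)
  have "\<phi> (i - 1) x = \<phi> (-1) (\<phi> i x)"
    using assms(1,4) by (auto simp: iter_add)
  then show ?case
    using assms(3) step2 by simp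
qed

lemma normal_step_pair:
  assumes "normal_step A B"
  shows "closed_normal_pair G T A B"
  using assms topological_group_axioms
  by (simp add: closed_normal_pair_def closed_normal_pair_axioms_def normal_step_def stable_subgroup_def)

lemma preimage_stable:
  assumes AB: "normal_step A B" and N: "N \<lhd> G\<lparr>carrier := A\<rparr> Mod B"
    "closedin (quotient_topology (G\<lparr>carrier := A\<rparr>) (subtopology T A) B) N"
    "induced_map (\<phi> 1) ` N = N"
  shows "normal_step A {x \<in> A. B #> x \<in> N}"
proof -
  interpret closed_normal_pair G T A B
    using AB by (rule normal_step_pair)
  let ?K = "{x \<in> A. B #> x \<in> N}"
  note A = normal_stepD(1)[OF AB] and B = normal_stepD(2)[OF AB]
  have induced: "induced_map (\<phi> 1) (B #> x) = B #> \<phi> 1 x" if "x \<in> A" for x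
    using that A_carrier subgroup.subset[OF B_subgroup] iter_image_stable[OF B] iter_hom
    by (intro induced_map_coset) auto
  have "\<phi> 1 x \<in> ?K" if "x \<in> ?K" for x
    using that induced[of x] N(3) stable_subgroupD(3)[OF A, of x 1] by auto
  \<comment> \<open>Backward invariance uses that the induced map carries \<open>N\<close> onto
    itself: the coset of \<open>x\<close> is the image of a coset \<open>C\<close> in
    \<open>N\<close>, and \<open>\<phi> (-1) x\<close> then lies in \<open>C\<close>.\<close>
  moreover have "\<phi> (-1) x \<in> ?K" if x: "x \<in> ?K" for x
  proof -
    have xA: "x \<in> A"
      using x by simp
    have "B #> x \<in> induced_map (\<phi> 1) ` N"
      using x N(3) by simp
    then obtain C where C: "C \<in> N" "B #> x = induced_map (\<phi> 1) C"
      by blast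
    then obtain y where y: "y \<in> A" "C = B #> y"
      using subgroup.subset[OF normal_imp_subgroup[OF N(1)]] unfolding carrier_Q by blast
    have c: "x \<in> carrier G" "y \<in> carrier G"
      using xA y(1) A_carrier by auto
    have "x \<otimes> inv (\<phi> 1 y) \<in> B"
      using C y induced[OF y(1)] r_coset_eq_iff[OF B_subgroup c(1) iter_closed[OF c(2)]] by simp
    then have "\<phi> (-1) (x \<otimes> inv (\<phi> 1 y)) \<in> B"
      by (rule stable_subgroupD(3)[OF B])
    moreover have "\<phi> (-1) (x \<otimes> inv (\<phi> 1 y)) = \<phi> (-1) x \<otimes> inv y"
      using c by (simp add: iter_mult iter_inv iter_closed iter_add iter_zero)
    ultimately have "B #> \<phi> (-1) x = C"
      using y(2) r_coset_eq_iff[OF B_subgroup iter_closed[OF c(1)] c(2)] by simp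
    then show ?thesis
      using C(1) stable_subgroupD(3)[OF A xA] by simp
  qed
  ultimately have "\<phi> i x \<in> ?K" if "x \<in> ?K" for i x
    using iter_invariantI[of ?K x i] A_carrier that by blast
  then have "stable_subgroup ?K"
    using preimage_subgroup[OF N(1)] closedin_preimage_TQ[OF N(2)] unfolding stable_subgroup_def by blast
  then show ?thesis
    unfolding normal_step_def using A preimage_normal[OF N(1)] by blast
qed

text \<open>Equal reach yields a window whose trace on the larger group lies in the smaller one.
  Over \<open>B\<close> this gives a discrete quotient, under \<open>A\<close> an open
  subgroup.\<close>

lemma simple_step_quotient:
  assumes "simple_step A B"
  defines "H \<equiv> G\<lparr>carrier := A\<rparr>"
  defines "Q \<equiv> H Mod B" and "TQ \<equiv> quotient_topology H (subtopology T A) B"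
  shows "B \<lhd> H"
    and "N \<lhd> Q \<Longrightarrow> closedin TQ N \<Longrightarrow> induced_map (\<phi> 1) ` N = N \<Longrightarrow>
      subtopology TQ N = discrete_topology N \<or> openin TQ N"
    and "TQ = discrete_topology (carrier Q) \<or> comm_group Q \<or> topologically_perfect Q TQ"
proof -
  have AB: "normal_step A B"
    using assms(1) unfolding simple_step_def by blast
  interpret closed_normal_pair G T A B
    using AB by (rule normal_step_pair)
  note A = normal_stepD(1)[OF AB] and B = normal_stepD(2)[OF AB]
  have discrete: "subtopology TQ ((\<lambda>x. B #> x) ` K) = discrete_topology ((\<lambda>x. B #> x) ` K)"
    if K: "normal_step A K" "B \<subseteq> K" "reach K = reach B" for K
  proof -
    note K' = normal_stepD(2)[OF K(1)]
    obtain k where "K \<inter> window {- int k..int k} \<subseteq> B"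
      using relatively_open_if_reach_eq[OF K' B K(2)] K(3) by metis
    then show ?thesis
      unfolding TQ_def H_def
      using discrete_image_TQ[OF normal_stepD(3)[OF K(1)] stable_subgroupD(1)[OF K'] K(2) openin_window one_in_window]
      by blast
  qed
  show "B \<lhd> H"
    unfolding H_def by (rule B_normal_H)
  show "subtopology TQ N = discrete_topology N \<or> openin TQ N"
    if N: "N \<lhd> Q" "closedin TQ N" "induced_map (\<phi> 1) ` N = N"
  proof -
    let ?K = "{x \<in> A. B #> x \<in> N}"
    note N' = N[unfolded Q_def TQ_def H_def]
    have K: "normal_step A ?K"
      using preimage_stable[OF AB N'] .
    have BK: "B \<subseteq> ?K" and img: "(\<lambda>x. B #> x) ` ?K = N"
      using subset_preimage[OF N'(1)] image_preimage[OF N'(1)] .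
    note K' = normal_stepD(2)[OF K]
    have "reach ?K = reach B \<or> reach ?K = reach A"
      using assms(1) K BK unfolding simple_step_def by blast
    then show ?thesis
    proof
      assume "reach ?K = reach B"
      then show ?thesis
        using discrete[OF K BK] unfolding img by blast
    next
      assume "reach ?K = reach A"
      then obtain k where "A \<inter> window {- int k..int k} \<subseteq> ?K"
        using relatively_open_if_reach_eq[OF A K' normal_stepD(3)[OF K]] by metis
      then have "openin (subtopology T A) ?K"
        using openin_subtopology_subgroup[OF A_subgroup stable_subgroupD(1)[OF K'] normal_stepD(3)[OF K]
          openin_window one_in_window] by blast
      then show ?thesis
        unfolding TQ_def H_def openin_TQ
        using subgroup.subset[OF normal_imp_subgroup[OF N'(1)]] by blast
    qed
  qed
  show "TQ = discrete_topology (carrier Q) \<or> comm_group Q \<or> topologically_perfect Q TQ"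
  proof -
    consider "reach A = reach B" | "derived_set G A \<subseteq> B" | "closed_derived A B = A"
      using assms(1) unfolding simple_step_def by blast
    then show ?thesis
    proof cases
      case 1
      \<comment> \<open>Taking \<open>K = A\<close> in \<open>discrete\<close> covers the whole
        quotient.\<close>
      have "normal_step A A"
        using A A_subgroup by (auto simp: normal_step_def subgroup.m_closed subgroup.m_inv_closed)
      then have "subtopology TQ (carrier Q) = discrete_topology (carrier Q)"
        using discrete[of A] 1 B_subset unfolding Q_def H_def carrier_Q by blast
      moreover have "topspace TQ = carrier Q"
        unfolding TQ_def Q_def H_def by (rule topspace_TQ)
      ultimately show ?thesis
        by (metis subtopology_topspace)
    next
      case 2
      then show ?thesis
        unfolding Q_def H_def using comm_group_Q by blast
    next
      case 3
      then show ?thesis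
        unfolding Q_def TQ_def H_def using topologically_perfect_Q by blast
    qed
  qed
qed

end

section \<open>Integer iterates of a bijection and assembly of the chain\<close>

text \<open>Depending on the sign of \<open>n\<close>, a step adds an outermost factor or cancels
  one; cancelling requires the iterates to stay in \<open>A\<close>.\<close>

lemma int_iterate_step:
  assumes "bij_betw f A A" "x \<in> A"
  shows "f (int_iterate A f n x) = int_iterate A f (n + 1) x"
    and "inv_into A f (int_iterate A f n x) = int_iterate A f (n - 1) x"
proof -
  have f: "f y \<in> A" "inv_into A f y \<in> A" "f (inv_into A f y) = y" "inv_into A f (f y) = y" if "y \<in> A" for y
    using assms(1) that
    by (auto simp: bij_betw_apply bij_betw_inv_into_right bij_betw_inv_into_left inv_into_into bij_betw_def)
  have closed: "(f ^^ k) x \<in> A" "(inv_into A f ^^ k) x \<in> A" for k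
    using f assms(2) by (induction k) auto
  have neg: "int_iterate A f (- int m) = inv_into A f ^^ m" for m
    by (cases "m = 0") (auto simp: int_iterate_def)
  have pos: "int_iterate A f (int m) = f ^^ m" for m
    by (simp add: int_iterate_def)
  show "f (int_iterate A f n x) = int_iterate A f (n + 1) x"
  proof (cases "0 \<le> n")
    case True
    then show ?thesis
      by (simp add: int_iterate_def nat_add_distrib)
  next
    case False
    then obtain m where m: "n = - int (Suc m)"
      by (cases n rule: int_cases) auto
    then have "n + 1 = - int m"
      by simp
    then show ?thesis
      using f(3)[OF closed(2)[of m]] unfolding m by (simp only: neg) simp
  qed
  show "inv_into A f (int_iterate A f n x) = int_iterate A f (n - 1) x"
  proof (cases "0 < n")
    case True
    then obtain m where m: "n = int (Suc m)"
      by (cases n rule: int_cases) (auto simp: gr0_conv_Suc)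
    then have "n - 1 = int m"
      by simp
    then show ?thesis
      using f(4)[OF closed(1)[of m]] unfolding m by (simp only: pos) simp
  next
    case False
    then have "n = - int (nat (- n))" "n - 1 = - int (Suc (nat (- n)))"
      by auto
    then show ?thesis
      using neg by (metis comp_apply funpow.simps(2))
  qed
qed

lemma int_iterate_add:
  assumes "bij_betw f A A" "x \<in> A"
  shows "int_iterate A f i (int_iterate A f j x) = int_iterate A f (i + j) x"
proof -
  have closed: "int_iterate A f j x \<in> A"
  proof (induction j rule: int_induct[where k = 0])
    case (step1 i)
    then show ?case
      using int_iterate_step(1)[OF assms] assms(1) bij_betw_apply by metis
  next
    case (step2 i)
    then show ?case
      using int_iterate_step(2)[OF assms] assms(1) bij_betw_apply bij_betw_inv_into by metis
  qed (simp add: int_iterate_def assms(2))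
  show ?thesis
  proof (induction i rule: int_induct[where k = 0])
    case (step1 i)
    then show ?case
      using int_iterate_step(1)[OF assms(1) closed, of i] int_iterate_step(1)[OF assms, of "i + j"]
      by (simp add: ac_simps)
  next
    case (step2 i)
    then show ?case
      using int_iterate_step(2)[OF assms(1) closed, of i] int_iterate_step(2)[OF assms, of "i + j"]
      by (simp add: algebra_simps)
  qed (simp add: int_iterate_def)
qed

theorem theoremB:
  fixes G :: "('a, 'b) monoid_scheme"
    and T :: "'a topology"
    and \<alpha> :: "'a \<Rightarrow> 'a"
  assumes "topological_group G T"
    and "totally_disconnected_space T"
    and "locally_compact_space T"
    and "topological_automorphism G T \<alpha>"
    and "expansive G T \<alpha>"
  shows "\<exists>(n::nat) (S :: nat \<Rightarrow> 'a set).
    S 0 = carrier G \<and> S n = {\<one>\<^bsub>G\<^esub>} \<and>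
    (\<forall>j\<in>{0..n}. subgroup (S j) G \<and> closedin T (S j) \<and> \<alpha> ` S j = S j) \<and>
    (\<forall>j\<in>{1..n}.
      let H = G\<lparr>carrier := S (j - 1)\<rparr>;
          Q = H Mod S j;
          TQ = quotient_topology H (subtopology T (S (j - 1))) (S j)
      in S j \<subseteq> S (j - 1) \<and> S j \<lhd> H \<and>
         (\<forall>N. N \<lhd> Q \<and> closedin TQ N \<and> induced_map \<alpha> ` N = N \<longrightarrow>
              subtopology TQ N = discrete_topology N \<or> openin TQ N) \<and>
         (TQ = discrete_topology (carrier Q) \<or> comm_group Q \<or> topologically_perfect Q TQ))"
proof -
  interpret topological_group G T
    by (rule assms(1))
  let ?\<phi> = "int_iterate (carrier G) \<alpha>"
  let ?\<beta> = "inv_into (carrier G) \<alpha>"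
  have \<alpha>: "\<alpha> \<in> iso G G" "continuous_map T T \<alpha>" "continuous_map T T ?\<beta>"
    using assms(4) unfolding topological_automorphism_def by blast+
  then have bij: "bij_betw \<alpha> (carrier G) (carrier G)" and hom: "\<alpha> \<in> hom G G"
    by (auto simp: iso_def)
  have "?\<beta> \<in> hom G G"
    using iso_set_sym[OF \<alpha>(1)] by (simp add: iso_def)
  have pow_hom: "f ^^ k \<in> hom G G" if "f \<in> hom G G" for f k
    using that by (induction k) (auto simp: hom_def Pi_iff)
  have pow_cont: "continuous_map T T (f ^^ k)" if "continuous_map T T f" for f k
    using that by (induction k) (auto simp: id_def[symmetric] intro: continuous_map_compose)
  obtain U where U: "identity_neighbourhood G T U" "(\<Inter>n. ?\<phi> n ` U) = {\<one>\<^bsub>G\<^esub>}"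
    using assms(5) unfolding expansive_def by blast
  then obtain W where W: "openin T W" "\<one>\<^bsub>G\<^esub> \<in> W" "W \<subseteq> U"
    unfolding identity_neighbourhood_def by blast
  obtain V where V: "subgroup V G" "openin T V" "compactin T V" "V \<subseteq> W"
    using exists_compact_open_subgroup[OF assms(2,3) W(1,2)] by blast
  interpret expansive_system G T ?\<phi> V
  proof (intro expansive_system.intro expansive_system_axioms.intro topological_group_axioms)
    show "?\<phi> i \<in> hom G G" "continuous_map T T (?\<phi> i)" for i
      using pow_hom pow_cont hom \<open>?\<beta> \<in> hom G G\<close> \<alpha> by (simp_all add: int_iterate_def)
    show "?\<phi> 0 x = x" for x
      by (simp add: int_iterate_def)
    show add: "?\<phi> i (?\<phi> j x) = ?\<phi> (i + j) x" if "x \<in> carrier G" for i j x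
      using int_iterate_add[OF bij that] .
    show "x = \<one>\<^bsub>G\<^esub>" if x: "x \<in> carrier G" "\<And>i. ?\<phi> i x \<in> V" for x
    proof -
      \<comment> \<open>Expansiveness concerns images of \<open>U\<close>: \<open>x\<close> is the
        image under \<open>?\<phi> n\<close> of \<open>?\<phi> (- n) x\<close>, which lies in
        \<open>V\<close> and so in \<open>U\<close>.\<close>
      have "x \<in> ?\<phi> n ` U" for n
      proof
        have "?\<phi> 0 x = x"
          by (simp add: int_iterate_def)
        then show "x = ?\<phi> n (?\<phi> (- n) x)"
          using add[OF x(1), of n "- n"] by simp
        show "?\<phi> (- n) x \<in> U"
          using x(2) V(4) W(3) by blast
      qed
      then show ?thesis
        using U(2) by blast
    qed
  qed (use V in auto)
  have \<phi>1: "?\<phi> 1 = \<alpha>"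
    by (simp add: int_iterate_def)
  obtain n where "(simple_step ^^ n) (carrier G) {\<one>\<^bsub>G\<^esub>}"
    using rtranclp_imp_relpowp[OF simple_chain_exists] by blast
  then obtain S where S: "S 0 = carrier G" "S n = {\<one>\<^bsub>G\<^esub>}" "\<And>i. i < n \<Longrightarrow> simple_step (S i) (S (Suc i))"
    unfolding relpowp_fun_conv by blast
  have steps: "simple_step (S (j - 1)) (S j)" if "j \<in> {1..n}" for j
    using S(3)[of "j - 1"] that by (cases j) auto
  \<comment> \<open>Index 0 is treated apart because no step ends there; every other member is the
    lower end of a step.\<close>
  have "stable_subgroup (S j)" if "j \<in> {0..n}" for j
  proof (cases j)
    case 0
    then show ?thesis
      using S(1) subgroup_self closedin_topspace[of T]
      by (simp add: stable_subgroup_def iter_closed topspace_eq_carrier)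
  next
    case (Suc i)
    then show ?thesis
      using steps[of j] that by (auto simp: simple_step_def normal_step_def)
  qed
  then have "\<forall>j\<in>{0..n}. subgroup (S j) G \<and> closedin T (S j) \<and> \<alpha> ` S j = S j"
    using stable_subgroupD(1,2) iter_image_stable[of _ 1] unfolding \<phi>1 by blast
  moreover have "let H = G\<lparr>carrier := S (j - 1)\<rparr>;
          Q = H Mod S j;
          TQ = quotient_topology H (subtopology T (S (j - 1))) (S j)
      in S j \<subseteq> S (j - 1) \<and> S j \<lhd> H \<and>
         (\<forall>N. N \<lhd> Q \<and> closedin TQ N \<and> induced_map \<alpha> ` N = N \<longrightarrow>
              subtopology TQ N = discrete_topology N \<or> openin TQ N) \<and>
         (TQ = discrete_topology (carrier Q) \<or> comm_group Q \<or> topologically_perfect Q TQ)"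
    if "j \<in> {1..n}" for j
  proof -
    note step = steps[OF that]
    have "S j \<subseteq> S (j - 1)"
      using step by (simp add: simple_step_def normal_step_def)
    then show ?thesis
      unfolding Let_def using simple_step_quotient[OF step, unfolded \<phi>1] by (intro conjI allI impI; (elim conjE)?)
  qed
  ultimately show ?thesis
    using S(1,2) by (intro exI[of _ n] exI[of _ S] conjI ballI) blast+
qed

end
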